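(* Let $k$ be an algebraically closed field of characteristic $0$ and let $N \geq 3$. Let $A = k[x_1,\ldots,x_N]/\langle x_1^2+\cdots+x_N^2-1\rangle$ be the algebra of polynomial functions on $\mathbb{S}^{N-1}$, regarded as an $sl_N(k)$-module via the action described in the context. Then, as an $sl_N(k)$-module, $A$ decomposes into a direct sum of two submodules $A = A_{odd}\oplus A_{ev}$, where $A_{odd}$ (resp. $A_{ev}$) is the subspace of $A$ spanned by (the images of) the monomials of odd (resp. even) degree. The $sl_N(k)$-module $A_{odd}$ is irreducible, while $A_{ev}$ has a unique proper non-zero submodule, which is $1$-dimensional and consists of the constant functions.
   Context: For $1\le a, b\le N$ let $\Delta_{ab} = x_b\frac{\partial}{\partial x_a} - x_a\frac{\partial}{\partial x_b}$ (so $\Delta_{aa}=0$); these induce derivations of $A$. Let $E_{ab}$ denote the matrix units. The Lie algebra $sl_N(k)$, spanned by $E_{ab}$ and $E_{aa}-E_{bb}$ with $1\le a\ne b\le N$, acts on $A$ by derivations through $$E_{ab}\mapsto -\sum_{p=1}^N x_b x_p\Delta_{ap},\qquad E_{aa}-E_{bb}\mapsto -\sum_{p=1}^N \left(x_a x_p\Delta_{ap} - x_b x_p\Delta_{bp}\right).$$ *)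

theory Defs
  imports
    "HOL-Analysis.Determinants"
    "HOL-Library.Poly_Mapping"
    "HOL-Computational_Algebra.Polynomial"
begin

subsection \<open>Multivariate polynomials\<close>

text \<open>
  The \<open>N\<close> variables are indexed by a finite type \<open>'n\<close> with \<open>N = CARD('n)\<close>. A monomial is an
  exponent vector \<open>'n \<Rightarrow>\<^sub>0 nat\<close>; a polynomial maps monomials to coefficients, and
  multiplication on \<open>\<Rightarrow>\<^sub>0\<close> is convolution.
\<close>

type_synonym ('n, 'k) mpoly = "('n \<Rightarrow>\<^sub>0 nat) \<Rightarrow>\<^sub>0 'k"

definition mvar :: "'n \<Rightarrow> ('n, 'k::comm_ring_1) mpoly" where
  "mvar i = Poly_Mapping.single (Poly_Mapping.single i 1) 1"

definition mconst :: "'k \<Rightarrow> ('n, 'k::comm_ring_1) mpoly" where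
  "mconst c = Poly_Mapping.single 0 c"

definition monom_degree :: "('n::finite \<Rightarrow>\<^sub>0 nat) \<Rightarrow> nat" where
  "monom_degree m = (\<Sum>i\<in>UNIV. Poly_Mapping.lookup m i)"

text \<open>If the exponent of \<open>i\<close> in \<open>m\<close> is zero, the truncated subtraction below is harmless,
  because the coefficient of that term is then zero.\<close>

definition mpderiv :: "'n \<Rightarrow> ('n, 'k::comm_ring_1) mpoly \<Rightarrow> ('n, 'k) mpoly" where
  "mpderiv i p = (\<Sum>m\<in>Poly_Mapping.keys p.
     Poly_Mapping.single (m - Poly_Mapping.single i 1)
       (of_nat (Poly_Mapping.lookup m i) * Poly_Mapping.lookup p m))"

definition mDelta :: "'n \<Rightarrow> 'n \<Rightarrow> ('n, 'k::comm_ring_1) mpoly \<Rightarrow> ('n, 'k) mpoly" where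
  "mDelta a b p = mvar b * mpderiv a p - mvar a * mpderiv b p"

definition sphere_poly :: "('n::finite, 'k::comm_ring_1) mpoly" where
  "sphere_poly = (\<Sum>i\<in>UNIV. mvar i ^ 2) - 1"

lemma mpoly_sum_single:
  fixes p :: "'a \<Rightarrow>\<^sub>0 'b::comm_monoid_add"
  shows "p = (\<Sum>m\<in>Poly_Mapping.keys p. Poly_Mapping.single m (Poly_Mapping.lookup p m))"
proof (rule poly_mapping_eqI)
  fix k
  have "Poly_Mapping.lookup (\<Sum>m\<in>Poly_Mapping.keys p. Poly_Mapping.single m (Poly_Mapping.lookup p m)) k
     = (\<Sum>m\<in>Poly_Mapping.keys p. if m = k then Poly_Mapping.lookup p m else 0)"
    unfolding lookup_sum by (intro sum.cong) (auto simp: lookup_single when_def)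
  also have "\<dots> = Poly_Mapping.lookup p k"
    by (auto simp: sum.delta not_in_keys_iff_lookup_eq_zero)
  finally show "Poly_Mapping.lookup p k = Poly_Mapping.lookup
    (\<Sum>m\<in>Poly_Mapping.keys p. Poly_Mapping.single m (Poly_Mapping.lookup p m)) k" by simp
qed

lemma mpoly_induct [case_names single add]:
  fixes p :: "'a \<Rightarrow>\<^sub>0 'b::comm_monoid_add"
  assumes single: "\<And>m c. P (Poly_Mapping.single m c)"
    and add: "\<And>p q. P p \<Longrightarrow> P q \<Longrightarrow> P (p + q)"
  shows "P p"
proof -
  have "P (\<Sum>m\<in>A. Poly_Mapping.single m (Poly_Mapping.lookup p m))" if "finite A" for A
    using that
  proof (induction A)
    case empty
    then show ?case using single[of undefined 0] by simp
  next
    case (insert x A)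
    then show ?case using single add by simp
  qed
  then show ?thesis
    using mpoly_sum_single[of p] by (metis finite_keys)
qed

lemma mpderiv_add: "mpderiv i (p + q) = mpderiv i p + mpderiv i q"
  unfolding mpderiv_def
  by (rule setsum_keys_plus_distrib) (simp_all add: algebra_simps flip: single_add)

lemma mpderiv_single:
  "mpderiv i (Poly_Mapping.single m c) =
     Poly_Mapping.single (m - Poly_Mapping.single i 1) (of_nat (Poly_Mapping.lookup m i) * c)"
  by (simp add: mpderiv_def)

lemma monom_diff_add:
  fixes m m' :: "'n \<Rightarrow>\<^sub>0 nat"
  assumes "Poly_Mapping.lookup m i \<noteq> 0"
  shows "m + m' - Poly_Mapping.single i 1 = (m - Poly_Mapping.single i 1) + m'"
  using assms by (intro poly_mapping_eqI) (auto simp: lookup_add lookup_minus lookup_single when_def)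

lemma mpderiv_mult:
  fixes p q :: "('n, 'k::comm_ring_1) mpoly"
  shows "mpderiv i (p * q) = mpderiv i p * q + p * mpderiv i q"
proof (induction p rule: mpoly_induct)
  case (single m c)
  show ?case
  proof (induction q rule: mpoly_induct)
    case (single m' c')
    let ?k = "Poly_Mapping.lookup m i" and ?k' = "Poly_Mapping.lookup m' i"
    let ?e = "Poly_Mapping.single i (1::nat)"
    have 1: "Poly_Mapping.single (m + m' - ?e) (of_nat ?k * c * c')
       = Poly_Mapping.single ((m - ?e) + m') (of_nat ?k * c * c')"
      by (cases "?k = 0") (simp_all add: monom_diff_add del: One_nat_def)
    have 2: "Poly_Mapping.single (m + m' - ?e) (of_nat ?k' * c * c')
       = Poly_Mapping.single (m + (m' - ?e)) (of_nat ?k' * c * c')"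
      using monom_diff_add[of m' i m]
      by (cases "?k' = 0") (simp_all add: add.commute del: One_nat_def)
    have "Poly_Mapping.single (m + m' - ?e) ((of_nat ?k + of_nat ?k') * (c * c'))
      = Poly_Mapping.single (m + m' - ?e) (of_nat ?k * c * c')
        + Poly_Mapping.single (m + m' - ?e) (of_nat ?k' * c * c')"
      by (simp add: algebra_simps flip: single_add)
    then show ?case
      by (simp only: mult_single mpderiv_single lookup_add of_nat_add 1 2) (simp add: mult_ac)
  next
    case (add q q')
    then show ?case by (simp add: mpderiv_add algebra_simps)
  qed
next
  case (add p p')
  then show ?case by (simp add: mpderiv_add algebra_simps)
qed

lemma mpderiv_mconst [simp]: "mpderiv i (mconst c) = 0"
  by (simp add: mconst_def mpderiv_single)

lemma mpderiv_mvar: "mpderiv i (mvar j) = (if i = j then 1 else 0)"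
  by (simp add: mvar_def mpderiv_single lookup_single when_def)

lemma mpderiv_0 [simp]: "mpderiv i 0 = 0"
  by (simp add: mpderiv_def)

lemma mpderiv_1 [simp]: "mpderiv i 1 = 0"
  using mpderiv_mconst[of i 1] by (simp add: mconst_def)

lemma mpderiv_diff: "mpderiv i (p - q) = mpderiv i p - mpderiv i q"
  using mpderiv_add[of i "p - q" q] by simp

lemma mDelta_add: "mDelta a b (p + q) = mDelta a b p + mDelta a b q"
  by (simp add: mDelta_def mpderiv_add algebra_simps)

lemma mDelta_diff: "mDelta a b (p - q) = mDelta a b p - mDelta a b q"
  by (simp add: mDelta_def mpderiv_diff algebra_simps)

lemma mDelta_mult: "mDelta a b (p * q) = mDelta a b p * q + p * mDelta a b q"
  by (simp add: mDelta_def mpderiv_mult algebra_simps)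

lemma mDelta_mconst [simp]: "mDelta a b (mconst c) = 0"
  by (simp add: mDelta_def)

lemma mpderiv_sum: "mpderiv i (sum f A) = (\<Sum>x\<in>A. mpderiv i (f x))"
  by (induction A rule: infinite_finite_induct) (simp_all add: mpderiv_add)

lemma mpderiv_sphere_poly: "mpderiv i sphere_poly = 2 * mvar i"
proof -
  have "mpderiv i sphere_poly = (\<Sum>j\<in>UNIV. if i = j then 2 * mvar j else 0)"
    unfolding sphere_poly_def mpderiv_diff mpderiv_sum power2_eq_square mpderiv_mult mpderiv_mvar
      mpderiv_1 diff_0_right
    by (intro sum.cong) auto
  then show ?thesis by simp
qed

lemma mDelta_sphere_poly: "mDelta a b sphere_poly = 0"
  by (simp add: mDelta_def mpderiv_sphere_poly algebra_simps)

text \<open>Evaluation at a point, used only to see that the quotient ring is not trivial.\<close>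

definition meval :: "('n::finite \<Rightarrow> 'k) \<Rightarrow> ('n, 'k::comm_ring_1) mpoly \<Rightarrow> 'k" where
  "meval v p = (\<Sum>m\<in>Poly_Mapping.keys p.
     Poly_Mapping.lookup p m * (\<Prod>i\<in>UNIV. v i ^ Poly_Mapping.lookup m i))"

lemma meval_add: "meval v (p + q) = meval v p + meval v q"
  unfolding meval_def
  by (rule setsum_keys_plus_distrib) (simp_all add: algebra_simps)

lemma meval_single:
  "meval v (Poly_Mapping.single m c) = c * (\<Prod>i\<in>UNIV. v i ^ Poly_Mapping.lookup m i)"
  by (simp add: meval_def)

lemma meval_mult: "meval v (p * q) = meval v p * meval v q"
proof (induction p rule: mpoly_induct)
  case (single m c)
  show ?case
  proof (induction q rule: mpoly_induct)
    case (single m' c')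
    then show ?case
      by (simp add: mult_single meval_single lookup_add power_add prod.distrib mult_ac)
  next
    case (add q q')
    then show ?case by (simp add: meval_add algebra_simps)
  qed
next
  case (add p p')
  then show ?case by (simp add: meval_add algebra_simps)
qed

lemma sphere_poly_not_dvd_1: "\<not> (sphere_poly :: ('n::finite, 'k::comm_ring_1) mpoly) dvd 1"
proof
  assume "(sphere_poly :: ('n, 'k) mpoly) dvd 1"
  then obtain h :: "('n, 'k) mpoly" where h: "1 = sphere_poly * h" by (elim dvdE)
  define v :: "'n \<Rightarrow> 'k" where "v = (\<lambda>i. if i = undefined then 1 else 0)"
  have m1: "meval v 1 = 1"
    using meval_single[of v 0 1] by simp
  have m0: "meval v 0 = 0"
    by (simp add: meval_def)
  have mv: "meval v (mvar i) = v i" for i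
  proof -
    have "(\<Prod>j\<in>UNIV. v j ^ Poly_Mapping.lookup (Poly_Mapping.single i (1::nat)) j)
        = (\<Prod>j\<in>UNIV. if j = i then v j else 1)"
      by (intro prod.cong) (auto simp: lookup_single when_def)
    then show ?thesis unfolding mvar_def meval_single by simp
  qed
  have ms: "meval v (sum f A) = (\<Sum>x\<in>A. meval v (f x))" for f :: "'n \<Rightarrow> ('n, 'k) mpoly" and A
    by (induction A rule: infinite_finite_induct) (simp_all add: meval_add m0)
  have "meval v ((sphere_poly :: ('n, 'k) mpoly) + 1) = (\<Sum>i\<in>UNIV. v i ^ 2)"
    by (simp add: sphere_poly_def ms power2_eq_square meval_mult mv)
  also have "\<dots> = (\<Sum>i\<in>(UNIV :: 'n set). if i = undefined then 1 else 0)"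
    unfolding v_def by (intro sum.cong) (auto simp: power2_eq_square)
  also have "\<dots> = 1" by simp
  finally have "meval v (sphere_poly :: ('n, 'k) mpoly) = 0"
    by (simp add: meval_add m1)
  then show False
    using m1 unfolding h meval_mult by simp
qed


subsection \<open>The algebra of polynomial functions on the sphere\<close>

definition sphere_rel :: "('n::finite, 'k::comm_ring_1) mpoly \<Rightarrow> ('n, 'k) mpoly \<Rightarrow> bool" where
  "sphere_rel p q \<longleftrightarrow> sphere_poly dvd p - q"

lemma equivp_sphere_rel: "equivp sphere_rel"
proof (rule equivpI)
  show "reflp sphere_rel"
    by (simp add: reflp_def sphere_rel_def)
  show "symp sphere_rel"
    unfolding symp_def sphere_rel_def by (metis dvd_minus_iff minus_diff_eq)
  show "transp sphere_rel"
    unfolding transp_def sphere_rel_def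
    by (metis (no_types, opaque_lifting) diff_add_cancel diff_diff_eq2 dvd_add add_diff_eq)
qed

quotient_type (overloaded) ('n, 'k) sphere_alg =
  "('n::finite, 'k::comm_ring_1) mpoly" / sphere_rel
  by (rule equivp_sphere_rel)

instantiation sphere_alg :: (finite, comm_ring_1) comm_ring_1
begin

lift_definition zero_sphere_alg :: "('a, 'b) sphere_alg" is 0 .

lift_definition one_sphere_alg :: "('a, 'b) sphere_alg" is 1 .

lift_definition plus_sphere_alg ::
  "('a, 'b) sphere_alg \<Rightarrow> ('a, 'b) sphere_alg \<Rightarrow> ('a, 'b) sphere_alg" is "(+)"
  unfolding sphere_rel_def by (metis add_diff_add dvd_add)

lift_definition uminus_sphere_alg ::
  "('a, 'b) sphere_alg \<Rightarrow> ('a, 'b) sphere_alg" is uminus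
  unfolding sphere_rel_def by (metis dvd_minus_iff minus_diff_minus)

lift_definition minus_sphere_alg ::
  "('a, 'b) sphere_alg \<Rightarrow> ('a, 'b) sphere_alg \<Rightarrow> ('a, 'b) sphere_alg" is "(-)"
proof -
  fix p q p' q' :: "('a, 'b) mpoly"
  assume "sphere_rel p q" "sphere_rel p' q'"
  then have "sphere_poly dvd (p - q) - (p' - q')"
    unfolding sphere_rel_def by (rule dvd_diff)
  then show "sphere_rel (p - p') (q - q')"
    unfolding sphere_rel_def by (simp add: algebra_simps)
qed

lift_definition times_sphere_alg ::
  "('a, 'b) sphere_alg \<Rightarrow> ('a, 'b) sphere_alg \<Rightarrow> ('a, 'b) sphere_alg" is "(*)"
proof -
  fix p q p' q' :: "('a, 'b) mpoly"
  assume "sphere_rel p q" "sphere_rel p' q'"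
  then have "sphere_poly dvd (p - q) * p' + q * (p' - q')"
    unfolding sphere_rel_def by (intro dvd_add dvd_mult dvd_mult2)
  then show "sphere_rel (p * p') (q * q')"
    unfolding sphere_rel_def by (simp add: algebra_simps)
qed

instance
proof
  fix a b c :: "('a, 'b) sphere_alg"
  have eq: "sphere_rel p q" if "p = q" for p q :: "('a, 'b) mpoly"
    using that by (simp add: sphere_rel_def)
  show "a * b * c = a * (b * c)" by transfer (rule eq, simp add: mult_ac)
  show "a * b = b * a" by transfer (rule eq, simp add: mult_ac)
  show "1 * a = a" by transfer (rule eq, simp)
  show "(a + b) * c = a * c + b * c" by transfer (rule eq, simp add: algebra_simps)
  show "a + b + c = a + (b + c)" by transfer (rule eq, simp add: algebra_simps)
  show "a + b = b + a" by transfer (rule eq, simp add: algebra_simps)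
  show "0 + a = a" by transfer (rule eq, simp)
  show "- a + a = 0" by transfer (rule eq, simp)
  show "a - b = a + - b" by transfer (rule eq, simp)
  show "(0 :: ('a, 'b) sphere_alg) \<noteq> 1"
    by transfer (use sphere_poly_not_dvd_1 in \<open>simp add: sphere_rel_def\<close>)
qed

end

definition sphere_of_poly :: "('n::finite, 'k::comm_ring_1) mpoly \<Rightarrow> ('n, 'k) sphere_alg" where
  "sphere_of_poly p = abs_sphere_alg p"

definition sphere_scale :: "'k \<Rightarrow> ('n::finite, 'k::comm_ring_1) sphere_alg \<Rightarrow> ('n, 'k) sphere_alg" where
  "sphere_scale c f = sphere_of_poly (mconst c) * f"

definition sphere_var :: "'n \<Rightarrow> ('n::finite, 'k::comm_ring_1) sphere_alg" where
  "sphere_var i = sphere_of_poly (mvar i)"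

lift_definition sphere_Delta ::
  "'n \<Rightarrow> 'n \<Rightarrow> ('n::finite, 'k::comm_ring_1) sphere_alg \<Rightarrow> ('n, 'k) sphere_alg" is mDelta
proof -
  fix a b :: 'n and p q :: "('n, 'k) mpoly"
  assume "sphere_rel p q"
  then obtain h where "p - q = sphere_poly * h"
    unfolding sphere_rel_def by (elim dvdE)
  then have "mDelta a b p - mDelta a b q = sphere_poly * mDelta a b h"
    by (simp add: mDelta_mult mDelta_sphere_poly flip: mDelta_diff)
  then show "sphere_rel (mDelta a b p) (mDelta a b q)"
    unfolding sphere_rel_def by simp
qed

definition sphere_odd :: "('n::finite, 'k::field) sphere_alg set" where
  "sphere_odd = module.span sphere_scale
     {sphere_of_poly (Poly_Mapping.single m 1) | m. odd (monom_degree m)}"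

definition sphere_even :: "('n::finite, 'k::field) sphere_alg set" where
  "sphere_even = module.span sphere_scale
     {sphere_of_poly (Poly_Mapping.single m 1) | m. even (monom_degree m)}"

definition sphere_constants :: "('n::finite, 'k::field) sphere_alg set" where
  "sphere_constants = {sphere_of_poly (mconst c) | c. True}"

lemma sphere_of_poly_add: "sphere_of_poly (p + q) = sphere_of_poly p + sphere_of_poly q"
  by (simp add: sphere_of_poly_def plus_sphere_alg.abs_eq)

lemma sphere_of_poly_mult: "sphere_of_poly (p * q) = sphere_of_poly p * sphere_of_poly q"
  by (simp add: sphere_of_poly_def times_sphere_alg.abs_eq)

lemma sphere_of_poly_1 [simp]: "sphere_of_poly 1 = 1"
  by (simp add: sphere_of_poly_def one_sphere_alg_def)

lemma sphere_of_poly_0 [simp]: "sphere_of_poly 0 = 0"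
  by (simp add: sphere_of_poly_def zero_sphere_alg_def)

lemma sphere_of_poly_surj: "\<exists>p. f = sphere_of_poly p"
  unfolding sphere_of_poly_def by (induction f rule: sphere_alg.abs_induct) blast

lemma sphere_of_poly_sum: "sphere_of_poly (sum f A) = (\<Sum>x\<in>A. sphere_of_poly (f x))"
  by (induction A rule: infinite_finite_induct) (simp_all add: sphere_of_poly_add)

lemma sphere_equation:
  "(\<Sum>i\<in>UNIV. sphere_var i * sphere_var i) = (1 :: ('n::finite, 'k::comm_ring_1) sphere_alg)"
proof -
  have "sphere_of_poly (\<Sum>i\<in>UNIV. mvar i * mvar i) = (1 :: ('n, 'k) sphere_alg)"
    by (simp add: sphere_of_poly_def one_sphere_alg_def sphere_alg.abs_eq_iff sphere_rel_def
        sphere_poly_def power2_eq_square)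
  then show ?thesis
    by (simp add: sphere_var_def sphere_of_poly_sum sphere_of_poly_mult)
qed

global_interpretation sphere_vs: vector_space
  "sphere_scale :: 'k::field \<Rightarrow> ('n::finite, 'k) sphere_alg \<Rightarrow> _"
proof
  fix a b :: 'k and x y :: "('n, 'k) sphere_alg"
  show "sphere_scale a (x + y) = sphere_scale a x + sphere_scale a y"
    by (simp add: sphere_scale_def algebra_simps)
  show "sphere_scale (a + b) x = sphere_scale a x + sphere_scale b x"
    by (simp add: sphere_scale_def mconst_def single_add sphere_of_poly_add algebra_simps)
  have "(mconst (a * b) :: ('n, 'k) mpoly) = mconst a * mconst b"
    by (simp add: mconst_def mult_single)
  then show "sphere_scale a (sphere_scale b x) = sphere_scale (a * b) x"
    by (simp add: sphere_scale_def sphere_of_poly_mult mult_ac)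
  show "sphere_scale 1 x = x"
    by (simp add: sphere_scale_def mconst_def)
qed


subsection \<open>The Lie algebra and its modules\<close>

definition mat_unit :: "'n \<Rightarrow> 'n \<Rightarrow> 'k::semiring_1^'n^'n" where
  "mat_unit a b = (\<chi> i j. if i = a \<and> j = b then 1 else 0)"

definition mat_scale :: "'k::semiring_1 \<Rightarrow> 'k^'n^'n \<Rightarrow> 'k^'n^'n" where
  "mat_scale c M = (\<chi> i j. c * M $ i $ j)"

definition sl :: "('k::comm_ring_1^'n^'n) set" where
  "sl = {M. trace M = 0}"

locale sl_module = vector_space scale
  for scale :: "'k::field \<Rightarrow> 'v::ab_group_add \<Rightarrow> 'v" +
  fixes act :: "'k^'n^'n \<Rightarrow> 'v \<Rightarrow> 'v"
  assumes act_add_left: "M \<in> sl \<Longrightarrow> M' \<in> sl \<Longrightarrow> act (M + M') v = act M v + act M' v"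
    and act_scale_left: "M \<in> sl \<Longrightarrow> act (mat_scale c M) v = scale c (act M v)"
    and act_add_right: "M \<in> sl \<Longrightarrow> act M (v + w) = act M v + act M w"
    and act_scale_right: "M \<in> sl \<Longrightarrow> act M (scale c v) = scale c (act M v)"
    and act_bracket: "M \<in> sl \<Longrightarrow> M' \<in> sl \<Longrightarrow>
      act (M ** M' - M' ** M) v = act M (act M' v) - act M' (act M v)"
begin

definition submodule :: "'v set \<Rightarrow> bool" where
  "submodule U \<longleftrightarrow> subspace U \<and> (\<forall>M\<in>sl. \<forall>v\<in>U. act M v \<in> U)"

definition irreducible :: "'v set \<Rightarrow> bool" where
  "irreducible U \<longleftrightarrow> submodule U \<and> U \<noteq> {0} \<and>
     (\<forall>W. submodule W \<and> W \<subseteq> U \<longrightarrow> W = {0} \<or> W = U)"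

definition direct_sum_decomposition :: "'v set \<Rightarrow> 'v set \<Rightarrow> bool" where
  "direct_sum_decomposition U W \<longleftrightarrow> submodule U \<and> submodule W \<and>
     U \<inter> W = {0} \<and> {u + w | u w. u \<in> U \<and> w \<in> W} = UNIV"

end

text \<open>
  The linear extension, to all matrices, of the given values on \<open>E\<^sub>a\<^sub>b\<close> and
  \<open>E\<^sub>a\<^sub>a - E\<^sub>b\<^sub>b\<close>; see \<open>sphere_act_mat_unit\<close>, \<open>sphere_act_mat_unit_diff\<close> and \<open>sl_eq_span\<close> below.
\<close>

definition sphere_act ::
  "'k::field^'n::finite^'n \<Rightarrow> ('n, 'k) sphere_alg \<Rightarrow> ('n, 'k) sphere_alg" where
  "sphere_act M f = - (\<Sum>a\<in>UNIV. \<Sum>b\<in>UNIV. sphere_scale (M $ a $ b)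
     (\<Sum>p\<in>UNIV. sphere_var b * sphere_var p * sphere_Delta a p f))"

lemma sphere_act_mat_unit:
  "sphere_act (mat_unit a b) f =
     - (\<Sum>p\<in>UNIV. sphere_var b * sphere_var p * sphere_Delta a p f)"
proof -
  let ?S = "\<lambda>a b. \<Sum>p\<in>UNIV. sphere_var b * sphere_var p * sphere_Delta a p f"
  have "(\<Sum>i\<in>UNIV. \<Sum>j\<in>UNIV. sphere_scale (mat_unit a b $ i $ j) (?S i j))
      = (\<Sum>i\<in>UNIV. \<Sum>j\<in>UNIV. if i = a then if j = b then ?S i j else 0 else 0)"
    by (intro sum.cong) (auto simp: mat_unit_def)
  also have "\<dots> = (\<Sum>i\<in>UNIV. if i = a then ?S i b else 0)"
    by (intro sum.cong) auto
  also have "\<dots> = ?S a b" by simp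
  finally show ?thesis by (simp add: sphere_act_def)
qed

lemma sphere_act_add_left: "sphere_act (M + M') f = sphere_act M f + sphere_act M' f"
  by (simp add: sphere_act_def sphere_vs.scale_left_distrib sum.distrib)

lemma sphere_act_scale_left: "sphere_act (mat_scale c M) f = sphere_scale c (sphere_act M f)"
  by (simp add: sphere_act_def mat_scale_def sphere_vs.scale_sum_right)

lemma sphere_act_diff_left: "sphere_act (M - M') f = sphere_act M f - sphere_act M' f"
  using sphere_act_add_left[of "M - M'" M' f] by simp

lemma sphere_act_mat_unit_diff:
  "sphere_act (mat_unit a a - mat_unit b b) f =
     - (\<Sum>p\<in>UNIV. sphere_var a * sphere_var p * sphere_Delta a p f
                  - sphere_var b * sphere_var p * sphere_Delta b p f)"
  by (simp add: sphere_act_diff_left sphere_act_mat_unit sum_subtractf)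

lemma mat_vector_space: "vector_space (mat_scale :: 'k::field \<Rightarrow> 'k^'n^'n \<Rightarrow> 'k^'n^'n)"
  by unfold_locales (simp_all add: mat_scale_def vec_eq_iff algebra_simps)

lemma sl_eq_span:
  "(sl :: ('k::field^'n::finite^'n) set) = module.span mat_scale
     ({mat_unit a b | a b. a \<noteq> b} \<union> {mat_unit a a - mat_unit b b | a b. a \<noteq> b})"
    (is "_ = module.span _ ?G")
proof -
  interpret vector_space "mat_scale :: 'k \<Rightarrow> 'k^'n^'n \<Rightarrow> 'k^'n^'n"
    by (rule mat_vector_space)
  have tr: "trace (mat_unit a b :: 'k^'n^'n) = (if a = b then 1 else 0)" for a b
  proof -
    have "trace (mat_unit a b :: 'k^'n^'n) = (\<Sum>i\<in>UNIV. if i = a then if a = b then 1 else 0 else 0)"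
      unfolding trace_def by (intro sum.cong) (auto simp: mat_unit_def)
    then show ?thesis by simp
  qed
  have "subspace (sl :: ('k^'n^'n) set)"
  proof (rule subspaceI)
    show "(0 :: 'k^'n^'n) \<in> sl" by (simp add: sl_def trace_def)
  next
    fix M M' :: "'k^'n^'n"
    assume "M \<in> sl" "M' \<in> sl"
    then show "M + M' \<in> sl" by (simp add: sl_def trace_add)
  next
    fix c and M :: "'k^'n^'n"
    assume "M \<in> sl"
    then show "mat_scale c M \<in> sl"
      by (simp add: sl_def trace_def mat_scale_def flip: sum_distrib_left)
  qed
  moreover have "?G \<subseteq> sl"
    by (auto simp: sl_def tr trace_sub)
  ultimately have 1: "span ?G \<subseteq> sl"
    by (rule span_minimal[rotated])
  have "M \<in> span ?G" if "M \<in> sl" for M :: "'k^'n^'n"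
  proof -
    define c :: 'n where "c = undefined"
    define T where "T a b = (if a = b then mat_scale (M $ a $ a) (mat_unit a a - mat_unit c c)
       else mat_scale (M $ a $ b) (mat_unit a b))" for a b
    have T: "T a b \<in> span ?G" for a b
    proof (cases "a = b")
      case True
      show ?thesis
      proof (cases "a = c")
        case True
        then show ?thesis using \<open>a = b\<close> span_zero by (simp add: T_def)
      next
        case False
        then have "mat_unit a a - mat_unit c c \<in> ?G" by blast
        then show ?thesis using \<open>a = b\<close> by (simp add: T_def span_base span_scale)
      qed
    next
      case False
      then have "mat_unit a b \<in> ?G" by blast
      then show ?thesis using False by (simp add: T_def span_base span_scale)
    qed
    have "(\<Sum>a\<in>UNIV. \<Sum>b\<in>UNIV. T a b) = M"
    proof -
      have "(\<Sum>a\<in>UNIV. \<Sum>b\<in>UNIV. T a b) $ i $ j = M $ i $ j" for i j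
      proof -
        have "(\<Sum>a\<in>UNIV. \<Sum>b\<in>UNIV. T a b) $ i $ j
          = (\<Sum>a\<in>UNIV. \<Sum>b\<in>UNIV. (if a = i then if b = j then M $ a $ b else 0 else 0)
              - (if a = b then if i = c \<and> j = c then M $ a $ a else 0 else 0))"
          unfolding sum_component
          by (intro sum.cong) (auto simp: T_def mat_scale_def mat_unit_def)
        also have "\<dots> = (\<Sum>a\<in>UNIV. if a = i then M $ a $ j else 0)
              - (\<Sum>a\<in>UNIV. if i = c \<and> j = c then M $ a $ a else 0)"
          unfolding sum_subtractf
          by (intro arg_cong2[of _ _ _ _ minus] sum.cong) auto
        also have "\<dots> = M $ i $ j"
          using that by (cases "i = c \<and> j = c") (auto simp: sl_def trace_def)
        finally show ?thesis .
      qed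
      then show ?thesis by (simp add: vec_eq_iff)
    qed
    moreover have "(\<Sum>a\<in>UNIV. \<Sum>b\<in>UNIV. T a b) \<in> span ?G"
      by (intro span_sum T)
    ultimately show ?thesis by simp
  qed
  with 1 show ?thesis by blast
qed

text \<open>The operators \<open>sphere_act M\<close> are derivations and respect the Lie bracket.\<close>

lemma sphere_Delta_of_poly: "sphere_Delta a b (sphere_of_poly p) = sphere_of_poly (mDelta a b p)"
  by (simp add: sphere_of_poly_def sphere_Delta.abs_eq)

lemma sphere_Delta_add: "sphere_Delta a b (f + g) = sphere_Delta a b f + sphere_Delta a b g"
  by transfer (simp add: sphere_rel_def mDelta_add)

lemma sphere_Delta_mult:
  "sphere_Delta a b (f * g) = sphere_Delta a b f * g + f * sphere_Delta a b g"
  by transfer (simp add: sphere_rel_def mDelta_mult)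

lemma sphere_Delta_var:
  "sphere_Delta a b (sphere_var i :: ('n::finite, 'k::comm_ring_1) sphere_alg) =
     (if a = i then sphere_var b else 0) - (if b = i then sphere_var a else 0)"
proof -
  have "mDelta a b (mvar i :: ('n, 'k) mpoly) = (if a = i then mvar b else 0) + (if b = i then - mvar a else 0)"
    by (simp add: mDelta_def mpderiv_mvar)
  moreover have "sphere_of_poly (- p) = - sphere_of_poly p" for p :: "('n, 'k) mpoly"
    using sphere_of_poly_add[of p "- p"] by (simp add: eq_neg_iff_add_eq_0 add.commute)
  ultimately show ?thesis
    by (simp add: sphere_var_def sphere_Delta_of_poly sphere_of_poly_add)
qed

lemma sphere_act_add_right: "sphere_act M (f + g) = sphere_act M f + sphere_act M g"
  by (simp add: sphere_act_def sphere_Delta_add algebra_simps sum.distrib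
      sphere_vs.scale_right_distrib)

lemma sphere_act_mult: "sphere_act M (f * g) = sphere_act M f * g + f * sphere_act M g"
proof -
  let ?S = "\<lambda>a b h. \<Sum>p\<in>UNIV. sphere_var b * sphere_var p * sphere_Delta a p h"
  have S: "?S a b (f * g) = ?S a b f * g + f * ?S a b g" for a b
    by (simp add: sphere_Delta_mult algebra_simps sum.distrib sum_distrib_left sum_distrib_right)
  have "sphere_scale c (?S a b (f * g))
      = sphere_scale c (?S a b f) * g + f * sphere_scale c (?S a b g)" for a b c
    unfolding S by (simp add: sphere_scale_def algebra_simps)
  then show ?thesis
    by (simp add: sphere_act_def sum.distrib sum_distrib_left sum_distrib_right)
qed

lemma sphere_act_const: "sphere_act M (sphere_of_poly (mconst c)) = 0"
  by (simp add: sphere_act_def sphere_Delta_of_poly)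

lemma sphere_act_scale_right: "sphere_act M (sphere_scale c f) = sphere_scale c (sphere_act M f)"
  by (simp add: sphere_scale_def sphere_act_mult sphere_act_const)

lemma sphere_derivation_zero:
  fixes D :: "('n::finite, 'k::comm_ring_1) sphere_alg \<Rightarrow> ('n, 'k) sphere_alg"
  assumes add: "\<And>f g. D (f + g) = D f + D g"
    and mult: "\<And>f g. D (f * g) = D f * g + f * D g"
    and const: "\<And>c. D (sphere_of_poly (mconst c)) = 0"
    and var: "\<And>i. D (sphere_var i) = 0"
  shows "D f = 0"
proof -
  have D1: "D (sphere_of_poly (Poly_Mapping.single m 1)) = 0" for m :: "'n \<Rightarrow>\<^sub>0 nat"
  proof (induction "monom_degree m" arbitrary: m)
    case 0
    then have "m = 0"
      by (intro poly_mapping_eqI) (simp add: monom_degree_def)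
    then show ?case using const[of 1] by (simp add: mconst_def)
  next
    case (Suc d)
    then have "(\<Sum>i\<in>UNIV. Poly_Mapping.lookup m i) \<noteq> 0"
      unfolding monom_degree_def by linarith
    then obtain i where i: "Poly_Mapping.lookup m i \<noteq> 0" by (meson sum.neutral)
    define m' where "m' = m - Poly_Mapping.single i 1"
    have m: "m = Poly_Mapping.single i 1 + m'"
      using i unfolding m'_def
      by (intro poly_mapping_eqI) (auto simp: lookup_add lookup_minus lookup_single when_def)
    have "monom_degree m = 1 + monom_degree m'"
      unfolding m by (simp add: monom_degree_def lookup_add sum.distrib lookup_single when_def)
    then have "D (sphere_of_poly (Poly_Mapping.single m' 1)) = 0" using Suc by simp
    moreover have "sphere_of_poly (Poly_Mapping.single m 1)
        = sphere_var i * (sphere_of_poly (Poly_Mapping.single m' 1) :: ('n, 'k) sphere_alg)"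
      unfolding m sphere_var_def mvar_def by (simp add: mult_single flip: sphere_of_poly_mult)
    ultimately show ?case by (simp add: mult var)
  qed
  have "D (sphere_of_poly p) = 0" for p
  proof (induction p rule: mpoly_induct)
    case (single m c)
    have "sphere_of_poly (Poly_Mapping.single m c)
       = sphere_of_poly (mconst c) * (sphere_of_poly (Poly_Mapping.single m 1) :: ('n, 'k) sphere_alg)"
      by (simp add: mconst_def mult_single flip: sphere_of_poly_mult)
    then show ?case by (simp add: mult const D1)
  next
    case (add p q)
    then show ?case by (simp add: sphere_of_poly_add assms(1))
  qed
  then show ?thesis using sphere_of_poly_surj[of f] by auto
qed

context
begin

private definition lin :: "'k::field^'n::finite^'n \<Rightarrow> 'n \<Rightarrow> ('n, 'k) sphere_alg" where
  "lin M i = (\<Sum>b\<in>UNIV. sphere_scale (M $ i $ b) (sphere_var b))"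

private definition quad :: "'k::field^'n::finite^'n \<Rightarrow> ('n, 'k) sphere_alg" where
  "quad M = (\<Sum>i\<in>UNIV. sphere_var i * lin M i)"

private lemma scale_mult_left: "sphere_scale c f * g = sphere_scale c (f * g)"
  by (simp add: sphere_scale_def mult_ac)

private lemma scale_mult_right: "f * sphere_scale c g = sphere_scale c (f * g)"
  by (simp add: sphere_scale_def mult_ac)

private lemma act_var: "sphere_act M (sphere_var i) = quad M * sphere_var i - lin M i"
proof -
  have S: "(\<Sum>p\<in>UNIV. sphere_var b * sphere_var p * sphere_Delta a p (sphere_var i))
     = (if a = i then sphere_var b else 0) - sphere_var b * sphere_var a * sphere_var i" for a b
  proof -
    have "(\<Sum>p\<in>UNIV. sphere_var b * sphere_var p * sphere_Delta a p (sphere_var i))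
      = (\<Sum>p\<in>UNIV. (if a = i then sphere_var b else 0) * (sphere_var p * sphere_var p)
           - (if p = i then sphere_var b * sphere_var a * sphere_var i else 0))"
      by (intro sum.cong) (auto simp: sphere_Delta_var algebra_simps)
    also have "\<dots> = (if a = i then sphere_var b else 0) * (\<Sum>p\<in>UNIV. sphere_var p * sphere_var p)
           - sphere_var b * sphere_var a * sphere_var i"
      unfolding sum_subtractf sum_distrib_left by simp
    finally show ?thesis by (simp add: sphere_equation)
  qed
  have "sphere_act M (sphere_var i) =
    - (\<Sum>a\<in>UNIV. (if a = i then lin M a else 0) - sphere_var a * lin M a * sphere_var i)"
    unfolding sphere_act_def S
    by (intro arg_cong[of _ _ uminus] sum.cong)
      (auto simp: lin_def sphere_vs.scale_right_diff_distrib sum_subtractf sum_distrib_left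
        sum_distrib_right scale_mult_left scale_mult_right mult_ac intro!: sum.cong)
  also have "\<dots> = quad M * sphere_var i - lin M i"
    by (simp add: sum_subtractf quad_def sum_distrib_right)
  finally show ?thesis .
qed

private lemma act_zero: "sphere_act M 0 = 0"
  using sphere_act_add_right[of M 0 0] by simp

private lemma act_uminus: "sphere_act M (- f) = - sphere_act M f"
  using sphere_act_add_right[of M f "- f"] by (simp add: act_zero eq_neg_iff_add_eq_0 add.commute)

private lemma act_diff: "sphere_act M (f - g) = sphere_act M f - sphere_act M g"
  using sphere_act_add_right[of M f "- g"] by (simp add: act_uminus)

private lemma act_sum: "sphere_act M (sum F A) = (\<Sum>x\<in>A. sphere_act M (F x))"
  by (induction A rule: infinite_finite_induct) (simp_all add: act_zero sphere_act_add_right)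

private lemma lin_mult: "lin (M' ** M) i = (\<Sum>b\<in>UNIV. sphere_scale (M' $ i $ b) (lin M b))"
proof -
  have "lin (M' ** M) i =
      (\<Sum>c\<in>UNIV. \<Sum>b\<in>UNIV. sphere_scale (M' $ i $ b * M $ b $ c) (sphere_var c))"
    by (simp add: lin_def matrix_matrix_mult_def sphere_vs.scale_sum_left)
  also have "\<dots> = (\<Sum>b\<in>UNIV. \<Sum>c\<in>UNIV. sphere_scale (M' $ i $ b * M $ b $ c) (sphere_var c))"
    by (rule sum.swap)
  finally show ?thesis
    by (simp add: lin_def sphere_vs.scale_sum_right)
qed

private lemma act_lin: "sphere_act M (lin M' i) = quad M * lin M' i - lin (M' ** M) i"
proof -
  have "sphere_act M (lin M' i) =
     (\<Sum>b\<in>UNIV. sphere_scale (M' $ i $ b) (quad M * sphere_var b - lin M b))"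
    by (simp add: lin_def[of M'] act_sum sphere_act_scale_right act_var)
  also have "\<dots> = quad M * lin M' i - lin (M' ** M) i"
    unfolding lin_mult
    by (simp add: lin_def[of M'] sphere_vs.scale_right_diff_distrib sum_subtractf
        sum_distrib_left scale_mult_right)
  finally show ?thesis .
qed

private lemma act_quad: "sphere_act M (quad M') =
  2 * quad M * quad M' - quad (M' ** M) - (\<Sum>i\<in>UNIV. lin M i * lin M' i)"
proof -
  have "sphere_act M (quad M') =
     (\<Sum>i\<in>UNIV. 2 * quad M * (sphere_var i * lin M' i) - sphere_var i * lin (M' ** M) i
        - lin M i * lin M' i)"
    unfolding quad_def[of M'] act_sum sphere_act_mult act_var act_lin
    by (intro sum.cong) (simp_all add: algebra_simps)
  then show ?thesis
    by (simp add: sum_subtractf quad_def[of M'] quad_def[of "M' ** M"] sum_distrib_left)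
qed

lemma sphere_act_bracket:
  fixes M M' :: "'k::field^'n::finite^'n"
  shows "sphere_act (M ** M' - M' ** M) f
     = sphere_act M (sphere_act M' f) - sphere_act M' (sphere_act M f)"
proof -
  define D where "D f = sphere_act M (sphere_act M' f) - sphere_act M' (sphere_act M f)
    - sphere_act (M ** M' - M' ** M) f" for f
  have lin_diff: "lin (M ** M' - M' ** M) i = lin (M ** M') i - lin (M' ** M) i" for i
    by (simp add: lin_def sphere_vs.scale_left_diff_distrib sum_subtractf)
  have quad_diff: "quad (M ** M' - M' ** M) = quad (M ** M') - quad (M' ** M)"
    by (simp add: quad_def lin_diff algebra_simps sum_subtractf)
  have sym: "(\<Sum>i\<in>UNIV. lin M i * lin M' i) = (\<Sum>i\<in>UNIV. lin M' i * lin M i)"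
    by (simp add: mult.commute)
  have "D f = 0"
  proof (rule sphere_derivation_zero[of D])
    show "D (f + g) = D f + D g" for f g
      by (simp add: D_def sphere_act_add_right)
    show "D (f * g) = D f * g + f * D g" for f g
      by (simp add: D_def sphere_act_mult sphere_act_add_right algebra_simps)
    show "D (sphere_of_poly (mconst c)) = 0" for c
      by (simp add: D_def sphere_act_const act_zero)
    show "D (sphere_var i) = 0" for i
      unfolding D_def act_var act_diff sphere_act_mult act_lin act_quad lin_diff quad_diff sym
      by (simp add: algebra_simps)
  qed
  then show ?thesis by (simp add: D_def)
qed

end

global_interpretation sphere_mod: sl_module
  "sphere_scale :: 'k::field \<Rightarrow> ('n::finite, 'k) sphere_alg \<Rightarrow> _" sphere_act
proof (intro sl_module.intro sl_module_axioms.intro)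
  show "vector_space (sphere_scale :: 'k \<Rightarrow> ('n, 'k) sphere_alg \<Rightarrow> _)"
    by (rule sphere_vs.vector_space_axioms)
qed (rule sphere_act_add_left sphere_act_scale_left sphere_act_add_right sphere_act_scale_right
    sphere_act_bracket)+

end

theory Submission
  imports Defs
begin

text \<open>
  The matrix unit \<open>E\<^sub>a\<^sub>b\<close> acts as \<open>- x\<^sub>b G\<^sub>a\<close>, where \<open>G\<^sub>a = \<Sum>\<^sub>p x\<^sub>p \<Delta>\<^sub>a\<^sub>p\<close> is the \<open>a\<close>-th component of the
  tangential gradient, and \<open>C = \<Sum>\<^sub>a G\<^sub>a\<^sup>2 = \<Sum>\<^sub>a\<^sub>b (x\<^sub>b G\<^sub>a)\<^sup>2\<close> is the spherical Laplacian, so submodules are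
  stable under \<open>C\<close>. On polynomials of degree at most \<open>n\<close> and of the parity of \<open>n\<close>, \<open>C\<close> has the
  eigenvalues \<open>\<lambda>\<^sub>m = - m (m + N - 2)\<close> with \<open>m \<le> n\<close>, \<open>m \<equiv> n\<close> modulo 2.

  Let \<open>U\<close> be a submodule. Up to the action, the commutator of \<open>C\<close> with multiplication by
  \<open>Q = x\<^sub>a x\<^sub>b\<close> is \<open>- 2 N Q\<close>; hence \<open>(C - (\<lambda>\<^sub>n - 2 N)) (Q f) \<in> U\<close> whenever \<open>f \<in> U\<close> has eigenvalue
  \<open>\<lambda>\<^sub>n\<close>. If \<open>n > 0\<close>, then \<open>\<lambda>\<^sub>n - 2 N\<close> is not an eigenvalue of the same parity, so \<open>Q f \<in> U\<close>. Thus \<open>U\<close>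
  is stable under multiplication by \<open>Q\<close> except for the constant components of its elements. A nonzero
  subspace stable under the action and under all \<open>Q\<close> is a full parity component, because
  second order partial derivatives of homogeneous representatives do not leave it. This settles
  the odd part.

  In the even part, if \<open>U\<close> is not contained in the constants, consider \<open>C U \<noteq> 0\<close>. If it is stable
  under all \<open>Q\<close>, it contains \<open>1\<close> and \<open>U\<close> contains every \<open>Q\<close>. Otherwise some \<open>Q\<^sub>1 f\<close> with
  \<open>f \<in> C U\<close> has a nonzero constant component; then \<open>1 \<in> U\<close>, and writing \<open>Q\<^sub>2 Q\<^sub>1 f = Q\<^sub>1 Q\<^sub>2 f\<close> modulo
  \<open>U\<close> shows that every \<open>Q\<^sub>2\<close> is a multiple of \<open>Q\<^sub>1\<close> modulo \<open>U\<close>. The operators \<open>\<Delta>\<^sub>a\<^sub>b\<close> act on this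
  quotient of dimension at most one by commuting scalars, so their commutators act by zero, and
  again \<open>U\<close> contains every \<open>Q\<close>.
\<close>

abbreviation X :: "'n \<Rightarrow> ('n::finite, 'k::comm_ring_1) sphere_alg" where
  "X \<equiv> sphere_var"

abbreviation K :: "'k \<Rightarrow> ('n::finite, 'k::comm_ring_1) sphere_alg" where
  "K c \<equiv> sphere_of_poly (mconst c)"

subsection \<open>Tangential gradient and Laplacian\<close>

lemma sphere_derivation_eqI:
  fixes D E :: "('n::finite, 'k::comm_ring_1) sphere_alg \<Rightarrow> ('n, 'k) sphere_alg"
  assumes "\<And>f g. D (f + g) = D f + D g" "\<And>f g. E (f + g) = E f + E g"
    and "\<And>f g. D (f * g) = D f * g + f * D g" "\<And>f g. E (f * g) = E f * g + f * E g"
    and "\<And>c. D (K c) = 0" "\<And>c. E (K c) = 0"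
    and "\<And>i. D (X i) = E (X i)"
  shows "D f = E f"
proof -
  have "D f - E f = 0"
    by (rule sphere_derivation_zero[of "\<lambda>f. D f - E f"]) (simp_all add: assms algebra_simps)
  then show ?thesis by simp
qed

definition sphere_grad :: "'n \<Rightarrow> ('n::finite, 'k::comm_ring_1) sphere_alg \<Rightarrow> ('n, 'k) sphere_alg"
  where "sphere_grad a f = (\<Sum>p\<in>UNIV. X p * sphere_Delta a p f)"

definition sphere_laplacian :: "('n::finite, 'k::comm_ring_1) sphere_alg \<Rightarrow> ('n, 'k) sphere_alg"
  where "sphere_laplacian f = (\<Sum>a\<in>UNIV. sphere_grad a (sphere_grad a f))"

lemma sphere_Delta_const [simp]: "sphere_Delta a b (K c) = 0"
  by (simp add: sphere_Delta_of_poly)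

lemma sphere_grad_const [simp]: "sphere_grad a (K c) = 0"
  by (simp add: sphere_grad_def)

lemma sphere_of_poly_mconst_1 [simp]: "sphere_of_poly (mconst 1) = 1"
  by (simp add: mconst_def)

lemma sphere_of_poly_mconst_0 [simp]: "sphere_of_poly (mconst 0) = 0"
  by (simp add: mconst_def)

lemma sphere_grad_1 [simp]: "sphere_grad a 1 = 0"
  using sphere_grad_const[of a 1] by simp

lemma sphere_grad_0 [simp]: "sphere_grad a 0 = 0"
  using sphere_grad_const[of a 0] by simp

lemma sphere_Delta_0 [simp]: "sphere_Delta a b 0 = 0"
  using sphere_Delta_const[of a b 0] by simp

lemma sphere_grad_add: "sphere_grad a (f + g) = sphere_grad a f + sphere_grad a g"
  by (simp add: sphere_grad_def sphere_Delta_add algebra_simps sum.distrib)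

lemma sphere_grad_mult: "sphere_grad a (f * g) = sphere_grad a f * g + f * sphere_grad a g"
  by (simp add: sphere_grad_def sphere_Delta_mult algebra_simps sum.distrib sum_distrib_left)

lemma sphere_grad_diff: "sphere_grad a (f - g) = sphere_grad a f - sphere_grad a g"
  using sphere_grad_add[of a "f - g" g] by simp

lemma sphere_Delta_diff: "sphere_Delta a b (f - g) = sphere_Delta a b f - sphere_Delta a b g"
  using sphere_Delta_add[of a b "f - g" g] by simp

lemma sphere_Delta_sum: "sphere_Delta a b (sum f S) = (\<Sum>i\<in>S. sphere_Delta a b (f i))"
  by (induction S rule: infinite_finite_induct) (simp_all add: sphere_Delta_add)

lemma sphere_grad_of_nat [simp]: "sphere_grad a (of_nat n) = 0"
  by (induction n) (simp_all add: sphere_grad_add)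

lemma sphere_grad_numeral [simp]: "sphere_grad a (numeral k) = 0"
  using sphere_grad_of_nat[of a "numeral k"] by simp

lemma sphere_grad_of_int [simp]: "sphere_grad a (of_int z) = 0"
  by (cases z rule: int_diff_cases) (simp add: sphere_grad_diff)

lemma sphere_grad_var:
  "sphere_grad a (X b :: ('n::finite, 'k::comm_ring_1) sphere_alg)
    = (if a = b then 1 else 0) - X a * X b"
proof -
  have "sphere_grad a (X b :: ('n, 'k) sphere_alg)
      = (\<Sum>p\<in>UNIV. (if a = b then X p * X p else 0) - (if p = b then X a * X b else 0))"
    unfolding sphere_grad_def by (intro sum.cong) (auto simp: sphere_Delta_var algebra_simps)
  also have "\<dots> = (if a = b then \<Sum>p\<in>UNIV. X p * X p else 0) - X a * X b"
    by (simp add: sum_subtractf)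
  finally show ?thesis by (simp add: sphere_equation)
qed

text \<open>Tangentiality: the gradient has no radial component. The sum is a derivation killing
  constants, so coordinates decide. In particular the identity matrix acts by zero.\<close>

lemma sum_sphere_var_grad:
  "(\<Sum>a\<in>UNIV. X a * sphere_grad a f) = (0 :: ('n::finite, 'k::comm_ring_1) sphere_alg)"
proof (rule sphere_derivation_zero[of "\<lambda>f. \<Sum>a\<in>UNIV. X a * sphere_grad a f"])
  fix i
  have "(\<Sum>a\<in>UNIV. X a * sphere_grad a (X i :: ('n, 'k) sphere_alg))
      = (\<Sum>a\<in>UNIV. (if a = i then X i else 0) - (X a * X a) * X i)"
    by (intro sum.cong) (auto simp: sphere_grad_var algebra_simps)
  also have "\<dots> = 0"
    by (simp add: sum_subtractf sphere_equation flip: sum_distrib_right)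
  finally show "(\<Sum>a\<in>UNIV. X a * sphere_grad a (X i :: ('n, 'k) sphere_alg)) = 0" .
qed (simp_all add: sphere_grad_add sphere_grad_mult algebra_simps sum.distrib sum_distrib_left)

text \<open>Expresses rotations through the operators \<open>x\<^sub>b G\<^sub>a\<close>, so that
  stability under the action gives stability under rotations.\<close>

lemma sphere_Delta_eq_grad: "sphere_Delta a b f = X b * sphere_grad a f - X a * sphere_grad b f"
  by (rule sphere_derivation_eqI[of "sphere_Delta a b"])
    (auto simp: sphere_Delta_add sphere_grad_add sphere_Delta_mult sphere_grad_mult
       sphere_Delta_var sphere_grad_var algebra_simps)

lemma sphere_act_mat_unit_grad: "sphere_act (mat_unit a b) f = - (X b * sphere_grad a f)"
  by (simp add: sphere_act_mat_unit sphere_grad_def sum_distrib_left mult.assoc)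

lemma sphere_act_grad:
  "sphere_act M f = - (\<Sum>a\<in>UNIV. \<Sum>b\<in>UNIV. sphere_scale (M $ a $ b) (X b * sphere_grad a f))"
  by (simp add: sphere_act_def sphere_grad_def sum_distrib_left mult.assoc)

text \<open>Holds because \<open>\<Sum>\<^sub>c x\<^sub>c G\<^sub>b x\<^sub>c = 0\<close>. It
  exhibits second derivatives as sums of compositions of two operators of the action.\<close>

lemma sphere_grad_grad:
  "sphere_grad b (sphere_grad a f) = (\<Sum>c\<in>UNIV. X c * sphere_grad b (X c * sphere_grad a f))"
proof -
  have "(\<Sum>c\<in>UNIV. X c * sphere_grad b (X c * sphere_grad a f))
     = (\<Sum>c\<in>UNIV. (if c = b then X c * sphere_grad a f else 0)
          - (X c * X c) * (X b * sphere_grad a f) + (X c * X c) * sphere_grad b (sphere_grad a f))"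
    by (intro sum.cong) (auto simp: sphere_grad_mult sphere_grad_var algebra_simps)
  also have "\<dots> = sphere_grad b (sphere_grad a f)"
    by (simp add: sum.distrib sum_subtractf sphere_equation flip: sum_distrib_right)
  finally show ?thesis by simp
qed

lemma sphere_laplacian_add: "sphere_laplacian (f + g) = sphere_laplacian f + sphere_laplacian g"
  by (simp add: sphere_laplacian_def sphere_grad_add sum.distrib)

lemma sphere_laplacian_diff: "sphere_laplacian (f - g) = sphere_laplacian f - sphere_laplacian g"
  by (simp add: sphere_laplacian_def sphere_grad_diff sum_subtractf)

lemma sphere_laplacian_1 [simp]: "sphere_laplacian 1 = 0"
  by (simp add: sphere_laplacian_def)

lemma sphere_laplacian_const_mult:
  "sphere_laplacian (K c * f) = K c * sphere_laplacian f"
  by (simp add: sphere_laplacian_def sphere_grad_mult sum_distrib_left)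

lemma sphere_laplacian_of_int_mult:
  "sphere_laplacian (of_int z * f) = of_int z * sphere_laplacian f"
  by (simp add: sphere_laplacian_def sphere_grad_mult sum_distrib_left)

text \<open>Product rule: tangentiality reduces the cross term to \<open>2 G\<^sub>b f\<close>, and
  \<open>C x\<^sub>b = - (N - 1) x\<^sub>b\<close>.\<close>

lemma sphere_laplacian_var_mult:
  fixes f :: "('n::finite, 'k::comm_ring_1) sphere_alg"
  shows "sphere_laplacian (X b * f)
    = X b * sphere_laplacian f + 2 * sphere_grad b f - of_int (int CARD('n) - 1) * (X b * f)"
proof -
  have "sphere_laplacian (X b * f) = (\<Sum>a\<in>UNIV. X b * sphere_grad a (sphere_grad a f)
     + 2 * (if a = b then sphere_grad b f else 0) - (2 * X b) * (X a * sphere_grad a f)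
     - X b * f - (if a = b then X b * f else 0) + (X a * X a) * (2 * (X b * f)))"
    unfolding sphere_laplacian_def
    by (intro sum.cong refl)
       (auto simp: sphere_grad_mult sphere_grad_add sphere_grad_var sphere_grad_diff algebra_simps)
  also have "\<dots> = X b * sphere_laplacian f + 2 * sphere_grad b f - of_nat CARD('n) * (X b * f)
      - X b * f + 2 * (X b * f)"
    unfolding sum.distrib sum_subtractf sum_distrib_left[symmetric] sum_distrib_right[symmetric]
      sphere_equation sum_sphere_var_grad sphere_laplacian_def by simp
  finally show ?thesis by (simp add: algebra_simps)
qed

text \<open>The last three summands lie in every submodule containing \<open>f\<close>; only the
  shift by \<open>- 2 N\<close> survives modulo it.\<close>

lemma sphere_laplacian_quad_mult:
  fixes f :: "('n::finite, 'k::comm_ring_1) sphere_alg"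
  shows "sphere_laplacian (X a * X b * f) = X a * X b * sphere_laplacian f
    - of_int (2 * int CARD('n)) * (X a * X b * f) + of_int (if a = b then 2 else 0) * f
    + 2 * (X b * sphere_grad a f) + 2 * (X a * sphere_grad b f)"
  unfolding mult.assoc sphere_laplacian_var_mult
  by (auto simp: sphere_grad_mult sphere_grad_var algebra_simps)

text \<open>Under rotations the gradient transforms as a vector. A commutator of derivations is a
  derivation, so coordinates decide.\<close>

lemma sphere_Delta_grad:
  fixes f :: "('n::finite, 'k::comm_ring_1) sphere_alg"
  shows "sphere_Delta a b (sphere_grad c f) = sphere_grad c (sphere_Delta a b f)
    + (if a = c then sphere_grad b f else 0) - (if b = c then sphere_grad a f else 0)"
proof -
  have "sphere_Delta a b (sphere_grad c f) - sphere_grad c (sphere_Delta a b f) =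
     (if a = c then sphere_grad b f else 0) - (if b = c then sphere_grad a f else 0)"
    by (rule sphere_derivation_eqI
        [of "\<lambda>f. sphere_Delta a b (sphere_grad c f) - sphere_grad c (sphere_Delta a b f)"])
      (auto simp: sphere_Delta_add sphere_grad_add sphere_Delta_mult sphere_grad_mult
         sphere_Delta_var sphere_grad_var sphere_Delta_diff sphere_grad_diff
         sphere_Delta_const[of _ _ 1, simplified] algebra_simps)
  then show ?thesis by (simp add: algebra_simps)
qed

lemma sphere_Delta_laplacian:
  fixes f :: "('n::finite, 'k::comm_ring_1) sphere_alg"
  shows "sphere_Delta a b (sphere_laplacian f) = sphere_laplacian (sphere_Delta a b f)"
proof -
  have "sphere_Delta a b (sphere_laplacian f) = (\<Sum>c\<in>UNIV.
    sphere_grad c (sphere_grad c (sphere_Delta a b f))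
    + (if a = c then sphere_grad a (sphere_grad b f) + sphere_grad b (sphere_grad a f) else 0)
    - (if b = c then sphere_grad a (sphere_grad b f) + sphere_grad b (sphere_grad a f) else 0))"
    unfolding sphere_laplacian_def sphere_Delta_sum
    by (intro sum.cong) (auto simp: sphere_Delta_grad sphere_grad_add sphere_grad_diff)
  also have "\<dots> = sphere_laplacian (sphere_Delta a b f)"
    by (simp add: sum.distrib sum_subtractf sphere_laplacian_def)
  finally show ?thesis .
qed

subsection \<open>Filtration by degree\<close>

text \<open>\<open>hom_image n\<close> is the image of the homogeneous polynomials of degree \<open>n\<close>. As
  \<open>\<Sum>\<^sub>i x\<^sub>i\<^sup>2 = 1\<close>, it contains \<open>hom_image m\<close> for all \<open>m \<le> n\<close> of the same parity.\<close>

inductive hom_image :: "nat \<Rightarrow> ('n::finite, 'k::field) sphere_alg \<Rightarrow> bool" where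
  one: "hom_image 0 1"
| add: "hom_image n f \<Longrightarrow> hom_image n g \<Longrightarrow> hom_image n (f + g)"
| scale: "hom_image n f \<Longrightarrow> hom_image n (sphere_scale c f)"
| var: "hom_image n f \<Longrightarrow> hom_image (Suc n) (X a * f)"

lemma hom_image_0 [simp]: "hom_image n 0"
proof -
  have "\<exists>f :: ('a, 'b) sphere_alg. hom_image n f"
    by (induction n) (auto intro: hom_image.intros)
  then show ?thesis by (metis hom_image.scale sphere_vs.scale_zero_left)
qed

lemma hom_image_const: "hom_image 0 (K c)"
  using hom_image.scale[OF hom_image.one, of c] by (simp add: sphere_scale_def)

lemma hom_image_0_iff: "hom_image 0 f \<longleftrightarrow> f \<in> sphere_constants"
proof
  have "f \<in> sphere_constants" if "hom_image n f" "n = 0" for n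
    using that
  proof (induction rule: hom_image.induct)
    case one
    then show ?case unfolding sphere_constants_def by (intro CollectI exI[of _ 1]) simp
  next
    case (add n f g)
    then show ?case unfolding sphere_constants_def
      by (auto simp: mconst_def simp flip: sphere_of_poly_add single_add)
  next
    case (scale n f c)
    then show ?case unfolding sphere_constants_def sphere_scale_def
      by (auto simp: mconst_def mult_single simp flip: sphere_of_poly_mult)
  qed simp
  then show "hom_image 0 f \<Longrightarrow> f \<in> sphere_constants" by simp
qed (auto simp: sphere_constants_def hom_image_const)

lemma sphere_scale_of_int: "sphere_scale (of_int z) f = of_int z * f"
proof -
  have nat: "sphere_of_poly (mconst (of_nat n :: 'b)) = (of_nat n :: ('a, 'b) sphere_alg)" for n
    by (induction n) (simp_all add: mconst_def single_add sphere_of_poly_add)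
  have diff: "K (c - d) = (K c - K d :: ('a, 'b) sphere_alg)"
    for c d :: 'b
    using sphere_of_poly_add[of "mconst (c - d)" "mconst d :: ('a, 'b) mpoly"]
    by (simp add: mconst_def flip: single_add)
  have "sphere_of_poly (mconst (of_int z :: 'b)) = (of_int z :: ('a, 'b) sphere_alg)"
    by (cases z rule: int_diff_cases) (simp add: diff nat)
  then show ?thesis by (simp add: sphere_scale_def)
qed

lemma hom_image_of_int: "hom_image n f \<Longrightarrow> hom_image n (of_int z * f)"
  by (metis sphere_scale_of_int hom_image.scale)

lemma hom_image_diff: "hom_image n f \<Longrightarrow> hom_image n g \<Longrightarrow> hom_image n (f - g)"
  using hom_image.add[of n f "of_int (-1) * g"] hom_image_of_int[of n g "-1"] by simp

lemma hom_image_sum: "(\<And>i. i \<in> S \<Longrightarrow> hom_image n (f i)) \<Longrightarrow> hom_image n (sum f S)"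
  by (induction S rule: infinite_finite_induct) (auto intro: hom_image.add)

lemma hom_image_Suc_Suc: "hom_image n f \<Longrightarrow> hom_image (Suc (Suc n)) f"
proof -
  assume "hom_image n f"
  then have "hom_image (Suc (Suc n)) (\<Sum>i\<in>UNIV. X i * (X i * f))"
    by (intro hom_image_sum hom_image.var)
  then show ?thesis
    by (simp add: sphere_equation flip: mult.assoc sum_distrib_right)
qed

lemma hom_image_mono: "hom_image n f \<Longrightarrow> n \<le> m \<Longrightarrow> even (m - n) \<Longrightarrow> hom_image m f"
proof -
  assume "hom_image n f" "n \<le> m" "even (m - n)"
  moreover have "hom_image (n + 2 * k) f" for k
    by (induction k) (use \<open>hom_image n f\<close> hom_image_Suc_Suc in auto)
  ultimately show ?thesis by (metis evenE le_add_diff_inverse)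
qed

lemma hom_image_monomial: "hom_image (monom_degree m) (sphere_of_poly (Poly_Mapping.single m 1))"
proof (induction "monom_degree m" arbitrary: m)
  case 0
  then have "m = 0"
    by (intro poly_mapping_eqI) (simp add: monom_degree_def)
  then show ?case using hom_image_const[of 1] by (simp add: mconst_def monom_degree_def)
next
  case (Suc d)
  then have "(\<Sum>i\<in>UNIV. Poly_Mapping.lookup m i) \<noteq> 0"
    unfolding monom_degree_def by linarith
  then obtain i where i: "Poly_Mapping.lookup m i \<noteq> 0" by (meson sum.neutral)
  define m' where "m' = m - Poly_Mapping.single i 1"
  have m: "m = Poly_Mapping.single i 1 + m'"
    using i unfolding m'_def
    by (intro poly_mapping_eqI) (auto simp: lookup_add lookup_minus lookup_single when_def)
  have "monom_degree m = Suc (monom_degree m')"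
    unfolding m by (simp add: monom_degree_def lookup_add sum.distrib lookup_single when_def)
  moreover have "sphere_of_poly (Poly_Mapping.single m 1)
      = X i * (sphere_of_poly (Poly_Mapping.single m' 1) :: ('a, 'b) sphere_alg)"
    unfolding m sphere_var_def mvar_def by (simp add: mult_single flip: sphere_of_poly_mult)
  ultimately show ?case using Suc by (simp add: hom_image.var)
qed

section \<open>Even and odd components\<close>

definition parity_part :: "bool \<Rightarrow> ('n::finite, 'k::field) sphere_alg set" where
  "parity_part e = sphere_vs.span
     {sphere_of_poly (Poly_Mapping.single m 1) | m. even (monom_degree m) = e}"

lemma sphere_even_eq: "sphere_even = parity_part True"
  and sphere_odd_eq: "sphere_odd = parity_part False"
  by (simp_all add: sphere_even_def sphere_odd_def parity_part_def)

lemma var_mult_parity_part: "f \<in> parity_part e \<Longrightarrow> X a * f \<in> parity_part (\<not> e)"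
  unfolding parity_part_def
proof (induction rule: sphere_vs.span_induct_alt)
  case base
  then show ?case by (simp add: sphere_vs.span_zero)
next
  case (step c f g)
  then obtain m where m: "f = sphere_of_poly (Poly_Mapping.single m 1)" "even (monom_degree m) = e"
    by blast
  have "X a * f = sphere_of_poly (Poly_Mapping.single (Poly_Mapping.single a 1 + m) 1)"
    unfolding m sphere_var_def mvar_def by (simp add: mult_single flip: sphere_of_poly_mult)
  moreover have "monom_degree (Poly_Mapping.single a 1 + m) = Suc (monom_degree m)"
    by (simp add: monom_degree_def lookup_add sum.distrib lookup_single when_def)
  ultimately have "X a * f \<in> sphere_vs.span
     {sphere_of_poly (Poly_Mapping.single m 1) | m. even (monom_degree m) = (\<not> e)}"
    using m(2) by (intro sphere_vs.span_base) auto
  moreover have "X a * (sphere_scale c f + g) = sphere_scale c (X a * f) + X a * g"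
    by (simp add: sphere_scale_def algebra_simps)
  ultimately show ?case using step by (simp add: sphere_vs.span_add sphere_vs.span_scale)
qed

lemma hom_image_imp_parity_part: "hom_image n f \<Longrightarrow> f \<in> parity_part (even n)"
proof (induction rule: hom_image.induct)
  case one
  have "sphere_of_poly (Poly_Mapping.single 0 1) = (1 :: ('a, 'b) sphere_alg)"
    by simp
  moreover have "even (monom_degree (0 :: 'a \<Rightarrow>\<^sub>0 nat))" by (simp add: monom_degree_def)
  ultimately show ?case
    unfolding parity_part_def by (intro sphere_vs.span_base CollectI exI[of _ 0]) simp
next
  case (var n f a)
  then show ?case using var_mult_parity_part[of f "even n" a] by simp
qed (auto simp: parity_part_def sphere_vs.span_add sphere_vs.span_scale)

text \<open>The spaces \<open>hom_image n\<close> with \<open>n\<close> of one parity form an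
  increasing chain, so any two elements share a degree.\<close>

lemma parity_part_iff: "f \<in> parity_part e \<longleftrightarrow> (\<exists>n. even n = e \<and> hom_image n f)"
proof
  show "\<exists>n. even n = e \<and> hom_image n f" if "f \<in> parity_part e"
    using that unfolding parity_part_def
  proof (induction rule: sphere_vs.span_induct_alt)
    case base
    show ?case by (rule exI[of _ "if e then 0 else 1"]) simp
  next
    case (step c f g)
    from step obtain n where n: "hom_image n g" "even n = e" by blast
    from step obtain m where m: "hom_image m f" "even m = e"
      by (auto intro: hom_image_monomial)
    from m n have "even (max m n) = e" "hom_image (max m n) f" "hom_image (max m n) g"
      by (auto intro: hom_image_mono simp: max_def)
    then show ?case by (blast intro: hom_image.add hom_image.scale)
  qed
qed (auto dest: hom_image_imp_parity_part)

lemma parity_part_sum: "\<exists>g h. f = g + h \<and> g \<in> parity_part False \<and> h \<in> parity_part True"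
proof -
  have "\<exists>g h. sphere_of_poly p = g + h \<and> g \<in> parity_part False \<and> h \<in> parity_part True"
      for p :: "('a, 'b) mpoly"
  proof (induction p rule: mpoly_induct)
    case (single m c)
    have "sphere_of_poly (Poly_Mapping.single m c)
       = sphere_scale c (sphere_of_poly (Poly_Mapping.single m 1) :: ('a, 'b) sphere_alg)"
      by (simp add: mconst_def mult_single sphere_scale_def flip: sphere_of_poly_mult)
    then have "sphere_of_poly (Poly_Mapping.single m c) \<in> parity_part (even (monom_degree m))"
      by (auto simp: parity_part_def intro: sphere_vs.span_scale sphere_vs.span_base)
    moreover have zero: "0 \<in> parity_part e" for e
      by (simp add: parity_part_def sphere_vs.span_zero)
    ultimately have "f = (if even (monom_degree m) then 0 else f)
          + (if even (monom_degree m) then f else 0)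
        \<and> (if even (monom_degree m) then 0 else f) \<in> parity_part False
        \<and> (if even (monom_degree m) then f else 0) \<in> parity_part True"
      if "f = sphere_of_poly (Poly_Mapping.single m c)" for f
      using that by (cases "even (monom_degree m)") simp_all
    then show ?case by blast
  next
    case (add p q)
    then obtain g h g' h'
      where "sphere_of_poly p = g + h" "g \<in> parity_part False" "h \<in> parity_part True"
       "sphere_of_poly q = g' + h'" "g' \<in> parity_part False" "h' \<in> parity_part True"
      by (elim exE conjE) (rule that)
    then have "sphere_of_poly (p + q) = (g + g') + (h + h')"
      "g + g' \<in> parity_part False" "h + h' \<in> parity_part True"
      by (auto simp: sphere_of_poly_add parity_part_def sphere_vs.span_add)
    then show ?case by blast
  qed
  then show ?thesis using sphere_of_poly_surj[of f] by metis
qed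

section \<open>Differential operators on the filtration\<close>

lemma hom_image_grad: "hom_image n f \<Longrightarrow> hom_image (Suc n) (sphere_grad a f)"
proof (induction rule: hom_image.induct)
  case (scale n f c)
  then show ?case using hom_image.scale[OF scale.IH, of c]
      by (simp add: sphere_scale_def sphere_grad_mult)
next
  case (var n f b)
  then have "hom_image (Suc (Suc n))
      ((if a = b then f else 0) - X a * (X b * f) + X b * sphere_grad a f)"
    by (intro hom_image.add hom_image_diff hom_image.var) (simp_all add: hom_image_Suc_Suc)
  moreover have "(if a = b then f else 0) - X a * (X b * f) + X b * sphere_grad a f
      = sphere_grad a (X b * f)"
    by (auto simp: sphere_grad_mult sphere_grad_var algebra_simps)
  ultimately show ?case by metis
qed (auto simp: sphere_grad_add intro: hom_image.add)

text \<open>Two gradients alone would raise the degree by two; the formula for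
  \<open>C (x\<^sub>b f)\<close> shows inductively that their sum does not raise it.\<close>

lemma hom_image_laplacian: "hom_image n f \<Longrightarrow> hom_image n (sphere_laplacian f)"
proof (induction rule: hom_image.induct)
  case (scale n f c)
  then show ?case using hom_image.scale[OF scale.IH, of c]
      by (simp add: sphere_scale_def sphere_laplacian_const_mult)
next
  case (var n f b)
  have "hom_image (Suc n)
    (X b * sphere_laplacian f + of_int 2 * sphere_grad b f - of_int (int CARD('a) - 1) * (X b * f))"
    using var by (intro hom_image_diff hom_image_of_int hom_image.add hom_image_grad hom_image.var)
  then show ?case by (simp add: sphere_laplacian_var_mult)
qed (auto simp: sphere_laplacian_add intro: hom_image.add)

text \<open>If \<open>f\<close> is the image of the homogeneous polynomial \<open>F\<close> of degree \<open>n\<close>, then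
  \<open>G\<^sub>a f + n x\<^sub>a f\<close> is the image of \<open>\<partial>F/\<partial>x\<^sub>a\<close>.\<close>

lemma hom_image_partial:
  "hom_image n f \<Longrightarrow> (case n of 0 \<Rightarrow> sphere_grad a f = 0
    | Suc m \<Rightarrow> hom_image m (sphere_grad a f + of_int (int n) * (X a * f)))"
proof (induction rule: hom_image.induct)
  case (add n f g)
  show ?case
  proof (cases n)
    case (Suc m)
    then have "hom_image m ((sphere_grad a f + of_int (int n) * (X a * f))
        + (sphere_grad a g + of_int (int n) * (X a * g)))"
      using add by (intro hom_image.add[of m "_ + _" "_ + _"]) simp_all
    then show ?thesis using Suc by (simp add: sphere_grad_add algebra_simps)
  qed (use add in \<open>simp add: sphere_grad_add\<close>)
next
  case (scale n f c)
  have "sphere_grad a (sphere_scale c f) + of_int (int n) * (X a * sphere_scale c f)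
     = sphere_scale c (sphere_grad a f + of_int (int n) * (X a * f))"
    by (simp add: sphere_scale_def sphere_grad_mult algebra_simps)
  note eq = this
  show ?case
  proof (cases n)
    case 0
    with scale show ?thesis by (simp add: sphere_scale_def sphere_grad_mult)
  next
    case (Suc m)
    have "hom_image m (sphere_scale c (sphere_grad a f + of_int (int n) * (X a * f)))"
      by (rule hom_image.scale) (use scale Suc in simp)
    then show ?thesis using Suc eq by simp
  qed
next
  case (var n f b)
  \<comment> \<open>The rule \<open>\<partial>\<^sub>a (x\<^sub>b F) = \<delta>\<^sub>a\<^sub>b F +
    x\<^sub>b \<partial>\<^sub>a F\<close>: the additional degree cancels the term
    \<open>- x\<^sub>a x\<^sub>b f\<close> of the gradient.\<close>
  have eq: "sphere_grad a (X b * f) + of_int (int (Suc n)) * (X a * (X b * f))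
     = (if a = b then f else 0) + X b * (sphere_grad a f + of_int (int n) * (X a * f))"
    by (auto simp: sphere_grad_mult sphere_grad_var algebra_simps)
  have "hom_image n (X b * (sphere_grad a f + of_int (int n) * (X a * f)))"
  proof (cases n)
    case (Suc m)
    then show ?thesis using var by (auto intro: hom_image.var)
  qed (use var in simp)
  then have "hom_image n
      ((if a = b then f else 0) + X b * (sphere_grad a f + of_int (int n) * (X a * f)))"
    using var by (intro hom_image.add) auto
  then show ?case unfolding nat.case eq .
qed auto

text \<open>Eigenvalue of the Laplacian on spherical harmonics of degree \<open>n\<close>, kept in
  the integers so that eigenvalues are compared by integer arithmetic.\<close>

definition eigenval :: "nat \<Rightarrow> nat \<Rightarrow> int" where
  "eigenval N n = - (int n * (int n + int N - 2))"

text \<open>If \<open>F\<close> is homogeneous of degree \<open>n\<close> with image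
  \<open>f\<close>, then \<open>C f - \<lambda>\<^sub>n f\<close> is the image of the Euclidean
  Laplacian of \<open>F\<close>. It makes \<open>C\<close> triangular on the filtration.\<close>

lemma hom_image_laplacian_diff:
  "hom_image n (f :: ('n::finite, 'k::field) sphere_alg) \<Longrightarrow>
    (if n < 2 then sphere_laplacian f = of_int (eigenval CARD('n) n) * f
     else hom_image (n - 2) (sphere_laplacian f - of_int (eigenval CARD('n) n) * f))"
proof (induction rule: hom_image.induct)
  case one
  then show ?case by (simp add: eigenval_def)
next
  case (add n f g)
  show ?case
  proof (cases "n < 2")
    case False
    then have "hom_image (n - 2) ((sphere_laplacian f - of_int (eigenval CARD('n) n) * f)
       + (sphere_laplacian g - of_int (eigenval CARD('n) n) * g))"
      using add by (intro hom_image.add) simp_all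
    then show ?thesis using False by (simp add: sphere_laplacian_add algebra_simps)
  qed (use add in \<open>simp add: sphere_laplacian_add algebra_simps\<close>)
next
  case (scale n f c)
  have "sphere_laplacian (sphere_scale c f) - of_int (eigenval CARD('n) n) * sphere_scale c f
     = sphere_scale c (sphere_laplacian f - of_int (eigenval CARD('n) n) * f)"
    unfolding sphere_scale_def sphere_laplacian_const_mult by (simp add: algebra_simps)
  with scale show ?case
    by (cases "n < 2") (simp_all add: hom_image.scale)
next
  case (var n f b)
  have e: "eigenval CARD('n) (Suc n) = eigenval CARD('n) n - 2 * int n - int CARD('n) + 1"
    by (simp add: eigenval_def algebra_simps)
  \<comment> \<open>For the Euclidean Laplacian this reads \<open>\<Delta> (x\<^sub>b F) = x\<^sub>b
    \<Delta> F + 2 \<partial>\<^sub>b F\<close>.\<close>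
  have eq: "sphere_laplacian (X b * f) - of_int (eigenval CARD('n) (Suc n)) * (X b * f)
     = X b * (sphere_laplacian f - of_int (eigenval CARD('n) n) * f)
       + of_int 2 * (sphere_grad b f + of_int (int n) * (X b * f))"
    unfolding e sphere_laplacian_var_mult by (simp add: algebra_simps)
  note p = hom_image_partial[OF var(1), of b]
  consider "n = 0" | "n = 1" | m where "n = Suc (Suc m)"
    by (metis One_nat_def nat.exhaust)
  then show ?case
  proof cases
    case 1
    then show ?thesis using eq p var by simp
  next
    case 2
    then have *: "sphere_laplacian f - of_int (eigenval CARD('n) n) * f = 0"
      using var by simp
    have "hom_image 0 (of_int 2 * (sphere_grad b f + of_int (int n) * (X b * f)))"
      by (rule hom_image_of_int) (use p 2 in simp)
    then have "hom_image 0
        (sphere_laplacian (X b * f) - of_int (eigenval CARD('n) (Suc n)) * (X b * f))"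
      unfolding eq * mult_zero_right add_0_left .
    then show ?thesis using 2 by simp
  next
    case 3
    then have "hom_image (Suc m)
        (sphere_laplacian (X b * f) - of_int (eigenval CARD('n) (Suc n)) * (X b * f))"
      unfolding eq
      by (intro hom_image.add[of "Suc m" "X b * _" "of_int 2 * _"] hom_image.var hom_image_of_int)
        (use p var in simp_all)
    then show ?thesis using 3 by simp
  qed
qed

subsection \<open>Submodules\<close>

lemma subspace_of_int_mult:
  assumes "sphere_vs.subspace U" "f \<in> U"
  shows "of_int z * f \<in> U"
  using sphere_vs.subspace_scale[OF assms, of "of_int z"] by (simp add: sphere_scale_of_int)

lemma subspace_of_int_mult_cancel:
  fixes f :: "('n::finite, 'k::field_char_0) sphere_alg"
  assumes "sphere_vs.subspace U" "of_int z * f \<in> U" "z \<noteq> 0"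
  shows "f \<in> U"
proof -
  have "sphere_scale (1 / of_int z) (of_int z * f) \<in> U"
    by (intro sphere_vs.subspace_scale assms)
  then show ?thesis using assms(3) by (simp flip: sphere_scale_of_int)
qed

lemma subspace_const_mult: "sphere_vs.subspace U \<Longrightarrow> f \<in> U \<Longrightarrow> K c * f \<in> U"
  using sphere_vs.subspace_scale[of U f c] by (simp add: sphere_scale_def)

lemma subspace_const_mult_cancel:
  assumes "sphere_vs.subspace U" "K c * f \<in> U" "c \<noteq> 0"
  shows "f \<in> U"
proof -
  have "sphere_scale (1 / c) (sphere_scale c f) \<in> U"
    unfolding sphere_scale_def[of c] by (intro sphere_vs.subspace_scale assms)
  then show ?thesis using assms(3) by simp
qed

definition gl_stable :: "('n::finite, 'k::field) sphere_alg set \<Rightarrow> bool" where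
  "gl_stable U \<longleftrightarrow> sphere_vs.subspace U \<and> (\<forall>a b. \<forall>f\<in>U. X b * sphere_grad a f \<in> U)"

text \<open>Equivalently, a submodule over the even subalgebra, which the products of two
  coordinates generate.\<close>

definition quad_stable :: "('n::finite, 'k::field) sphere_alg set \<Rightarrow> bool" where
  "quad_stable U \<longleftrightarrow> sphere_vs.subspace U \<and> (\<forall>a b. \<forall>f\<in>U. X a * (X b * f) \<in> U)"

lemma gl_stable_subspace: "gl_stable U \<Longrightarrow> sphere_vs.subspace U"
  by (simp add: gl_stable_def)

lemma gl_stableD: "gl_stable U \<Longrightarrow> f \<in> U \<Longrightarrow> X b * sphere_grad a f \<in> U"
  by (simp add: gl_stable_def)

lemma quad_stableD: "quad_stable U \<Longrightarrow> f \<in> U \<Longrightarrow> X a * (X b * f) \<in> U"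
  by (simp add: quad_stable_def)

lemma gl_stable_grad_grad:
  assumes "gl_stable U" "f \<in> U"
  shows "sphere_grad b (sphere_grad a f) \<in> U"
  unfolding sphere_grad_grad
  by (intro sphere_vs.subspace_sum gl_stable_subspace gl_stableD assms)

lemma gl_stable_laplacian:
  assumes "gl_stable U" "f \<in> U"
  shows "sphere_laplacian f \<in> U"
  unfolding sphere_laplacian_def
  by (intro sphere_vs.subspace_sum gl_stable_subspace gl_stable_grad_grad assms)

lemma gl_stable_Delta:
  assumes "gl_stable U" "f \<in> U"
  shows "sphere_Delta a b f \<in> U"
  unfolding sphere_Delta_eq_grad
  by (intro sphere_vs.subspace_diff gl_stable_subspace gl_stableD assms)

text \<open>Only the diagonal units need an argument: the identity acts by zero, so
  \<open>N E\<^sub>b\<^sub>b\<close> acts as the sum of all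
  \<open>E\<^sub>b\<^sub>b - E\<^sub>c\<^sub>c\<close>, and \<open>N\<close> is invertible.\<close>

lemma submodule_imp_gl_stable:
  fixes U :: "('n::finite, 'k::field_char_0) sphere_alg set"
  assumes "sphere_mod.submodule U"
  shows "gl_stable U"
  unfolding gl_stable_def
proof (intro conjI allI ballI)
  show sub: "sphere_vs.subspace U"
    using assms by (simp add: sphere_mod.submodule_def)
  have neg: "f \<in> U" if "- f \<in> U" for f
    using sphere_vs.subspace_neg[OF sub that] by simp
  fix a b :: 'n and f :: "('n, 'k) sphere_alg"
  assume f: "f \<in> U"
  interpret M: vector_space "mat_scale :: 'k \<Rightarrow> 'k^'n^'n \<Rightarrow> 'k^'n^'n"
    by (rule mat_vector_space)
  have act: "sphere_act M f \<in> U" if "M \<in> sl" for M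
    using assms f that by (simp add: sphere_mod.submodule_def)
  have diff: "X b * sphere_grad b f - X c * sphere_grad c f \<in> U" for b c
  proof (cases "b = c")
    case False
    then have "mat_unit b b - mat_unit c c \<in> (sl :: ('k^'n^'n) set)"
      unfolding sl_eq_span by (blast intro: M.span_base)
    from act[OF this] have "- (X b * sphere_grad b f - X c * sphere_grad c f) \<in> U"
      by (simp add: sphere_act_diff_left sphere_act_mat_unit_grad)
    then show ?thesis by (rule neg)
  qed (simp add: sphere_vs.subspace_0[OF sub])
  show "X b * sphere_grad a f \<in> U"
  proof (cases "a = b")
    case True
    have "(\<Sum>c\<in>UNIV. X b * sphere_grad b f - X c * sphere_grad c f) \<in> U"
      by (intro sphere_vs.subspace_sum sub diff)
    then have "of_int (int CARD('n)) * (X b * sphere_grad b f) \<in> U"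
      by (simp add: sum_subtractf sum_sphere_var_grad)
    from subspace_of_int_mult_cancel[OF sub this] True show ?thesis by simp
  next
    case False
    then have "mat_unit a b \<in> (sl :: ('k^'n^'n) set)"
      unfolding sl_eq_span by (blast intro: M.span_base)
    from act[OF this] show ?thesis
      by (simp add: sphere_act_mat_unit_grad neg)
  qed
qed

lemma gl_stable_imp_submodule: "gl_stable U \<Longrightarrow> sphere_mod.submodule U"
  unfolding sphere_mod.submodule_def sphere_act_grad
  by (intro conjI ballI sphere_vs.subspace_neg sphere_vs.subspace_sum sphere_vs.subspace_scale
      gl_stableD gl_stable_subspace)

lemma gl_stable_parity_part: "gl_stable (parity_part e)"
  unfolding gl_stable_def
proof (intro conjI allI ballI)
  show "sphere_vs.subspace (parity_part e)"
    by (simp add: parity_part_def)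
next
  fix a b f assume "f \<in> parity_part e"
  then obtain n where "even n = e" "hom_image n f" by (auto simp: parity_part_iff)
  then have "hom_image (Suc (Suc n)) (X b * sphere_grad a f)" "even (Suc (Suc n)) = e"
    by (simp_all add: hom_image.var hom_image_grad)
  then show "X b * sphere_grad a f \<in> parity_part e"
    unfolding parity_part_iff by blast
qed

section \<open>Spectral arguments\<close>

text \<open>As \<open>z\<close> is not an eigenvalue, \<open>C - z\<close> is injective modulo
  \<open>U\<close>. Inductively \<open>h' = (C - \<lambda>\<^sub>n) h\<close>, of lower degree, lies
  in \<open>U\<close>, and \<open>(C - z) h - h'\<close> is a nonzero multiple of
  \<open>h\<close>.\<close>

lemma mem_of_laplacian_diff_mem:
  fixes h :: "('n::finite, 'k::field_char_0) sphere_alg"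
  assumes U: "sphere_vs.subspace U" "\<And>f. f \<in> U \<Longrightarrow> sphere_laplacian f \<in> U"
    and h: "hom_image n h" "sphere_laplacian h - of_int z * h \<in> U"
    and z: "\<And>m. even m = even n \<Longrightarrow> z \<noteq> eigenval CARD('n) m"
  shows "h \<in> U"
  using h z
proof (induction n arbitrary: h rule: less_induct)
  case (less n)
  define l where "l = eigenval CARD('n) n"
  define h' where "h' = sphere_laplacian h - of_int l * h"
  have "sphere_laplacian h' - of_int z * h'
     = sphere_laplacian (sphere_laplacian h - of_int z * h)
       - of_int l * (sphere_laplacian h - of_int z * h)"
    unfolding h'_def sphere_laplacian_diff sphere_laplacian_of_int_mult by (simp add: algebra_simps)
  also have "\<dots> \<in> U"
    by (intro sphere_vs.subspace_diff subspace_of_int_mult U less.prems(2))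
  finally have h': "sphere_laplacian h' - of_int z * h' \<in> U" .
  have "h' \<in> U"
  proof (cases "n < 2")
    case True
    then show ?thesis
      using hom_image_laplacian_diff[OF less.prems(1)] sphere_vs.subspace_0[OF U(1)]
      by (simp add: h'_def l_def)
  next
    case False
    then have hom: "hom_image (n - 2) h'"
      using hom_image_laplacian_diff[OF less.prems(1)] by (simp add: h'_def l_def)
    have "z \<noteq> eigenval CARD('n) m" if "even m = even (n - 2)" for m
      by (rule less.prems(3)) (use that False in \<open>auto simp: even_diff_nat\<close>)
    from less.IH[OF _ hom h' this] False show ?thesis by simp
  qed
  then have "(sphere_laplacian h - of_int z * h) - h' \<in> U"
    by (intro sphere_vs.subspace_diff U less.prems(2))
  then have "of_int (l - z) * h \<in> U"
    by (simp add: h'_def algebra_simps)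
  moreover have "l - z \<noteq> 0"
    using less.prems(3)[of n] by (simp add: l_def)
  ultimately show ?case by (rule subspace_of_int_mult_cancel[OF U(1)])
qed

text \<open>Equality would mean \<open>(m - n) (m + n + N - 2) = 2 N\<close>. The left side is at
  most 0 for \<open>m \<le> n\<close> and too large for \<open>m \<ge> n + 4\<close>;
  \<open>m = n + 2\<close> forces \<open>n = 0\<close>.\<close>

lemma eigenval_shift:
  assumes "even m = even n" "n > 0" "N > 0"
  shows "eigenval N n - 2 * int N \<noteq> eigenval N m"
proof
  assume eq: "eigenval N n - 2 * int N = eigenval N m"
  have *: "(int m - int n) * (int m + int n + int N - 2) = 2 * int N"
    using eq by (simp add: eigenval_def algebra_simps)
  consider "m \<le> n" | "m = n + 2" | "m \<ge> n + 4"
  proof -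
    assume a: "m \<le> n \<Longrightarrow> thesis" "m = n + 2 \<Longrightarrow> thesis" "n + 4 \<le> m \<Longrightarrow> thesis"
    have "m \<noteq> n + 1" "m \<noteq> n + 3" using assms by auto
    then show thesis using a by linarith
  qed
  then show False
  proof cases
    case 1
    \<comment> \<open>By parity; a gap of two makes the second factor nonnegative even for small
      \<open>N\<close>.\<close>
    then have "m = n \<or> m + 2 \<le> n"
      using assms(1) by presburger
    then have "(int m - int n) * (int m + int n + int N - 2) \<le> 0"
    proof
      assume "m + 2 \<le> n"
      then show ?thesis by (intro mult_nonpos_nonneg) simp_all
    qed simp
    then show ?thesis using * assms by simp
  next
    case 2
    then show ?thesis using * assms by simp
  next
    case 3
    then have "4 * (int m + int n + int N - 2) \<le> (int m - int n) * (int m + int n + int N - 2)"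
      by (intro mult_right_mono) auto
    then show ?thesis using * 3 assms by simp
  qed
qed

text \<open>Replacing \<open>f\<close> by \<open>C f\<close> removes the constant component, for
  which \<open>eigenval_shift\<close> fails. The induction strips the top eigenvalue.\<close>

lemma quad_mult_laplacian_mem:
  fixes f :: "('n::finite, 'k::field_char_0) sphere_alg"
  assumes U: "gl_stable U" and f: "hom_image n f" "f \<in> U"
  shows "X a * (X b * sphere_laplacian f) \<in> U"
  using f
proof (induction n arbitrary: f rule: less_induct)
  case (less n)
  note sub = gl_stable_subspace[OF U]
  define l where "l = eigenval CARD('n) n"
  define g where "g = sphere_laplacian f"
  have g: "hom_image n g" "g \<in> U"
    by (simp_all add: g_def hom_image_laplacian less.prems gl_stable_laplacian[OF U])
  define f' where "f' = g - of_int l * f"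
  have f': "f' \<in> U"
    unfolding f'_def by (intro sphere_vs.subspace_diff subspace_of_int_mult sub g less.prems(2))
  show ?case
  proof (cases n)
    case 0
    then have "g = 0"
      using hom_image_laplacian_diff[OF less.prems(1)] by (simp add: g_def eigenval_def)
    then show ?thesis using sphere_vs.subspace_0[OF sub] by (simp add: g_def)
  next
    case (Suc k)
    have IH: "X a * (X b * sphere_laplacian f') \<in> U"
    proof (cases "n < 2")
      case True
      then have "f' = 0"
        using hom_image_laplacian_diff[OF less.prems(1)] by (simp add: f'_def g_def l_def)
      then show ?thesis using sphere_vs.subspace_0[OF sub] by (simp add: sphere_laplacian_def)
    next
      case False
      then show ?thesis
        using less.IH[of "n - 2" f'] f' hom_image_laplacian_diff[OF less.prems(1)]
        by (simp add: f'_def g_def l_def)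
    qed
    define h where "h = X a * (X b * g)"
    \<comment> \<open>Here \<open>C f' = C g - \<lambda>\<^sub>n g\<close>, so the term
      \<open>Q (C g - \<lambda>\<^sub>n g)\<close> falls under the induction hypothesis.\<close>
    have "sphere_laplacian h - of_int (l - 2 * int CARD('n)) * h
      = X a * (X b * sphere_laplacian f') + of_int (if a = b then 2 else 0) * g
       + of_int 2 * (X b * sphere_grad a g) + of_int 2 * (X a * sphere_grad b g)"
      using sphere_laplacian_quad_mult[of a b g]
      unfolding h_def f'_def sphere_laplacian_diff sphere_laplacian_of_int_mult g_def[symmetric]
      by (simp add: algebra_simps)
    also have "\<dots> \<in> U"
      by (intro sphere_vs.subspace_add subspace_of_int_mult sub IH gl_stableD[OF U] g)
    finally have "sphere_laplacian h - of_int (l - 2 * int CARD('n)) * h \<in> U" .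
    moreover have "hom_image (Suc (Suc n)) h"
      unfolding h_def by (intro hom_image.var g)
    ultimately have "h \<in> U"
      using Suc eigenval_shift[of _ n "CARD('n)"]
      by (intro mem_of_laplacian_diff_mem[OF sub, of "Suc (Suc n)" h "l - 2 * int CARD('n)"])
         (auto simp: l_def gl_stable_laplacian[OF U])
    then show ?thesis by (simp add: h_def g_def)
  qed
qed

lemma of_int_mult_eq_0:
  fixes f :: "('n::finite, 'k::field_char_0) sphere_alg"
  assumes "of_int z * f = 0" "z \<noteq> 0"
  shows "f = 0"
  using subspace_of_int_mult_cancel[of "{0}" z f] assms sphere_vs.subspace_single_0 by auto

lemma eigenval_inj:
  assumes "eigenval N n = eigenval N m" "N \<ge> 2"
  shows "n = m"
proof (rule ccontr)
  assume "n \<noteq> m"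
  then have "int n + int m + int N - 2 \<noteq> 0" using assms(2) by linarith
  moreover have "(int n - int m) * (int n + int m + int N - 2) = 0"
    using assms(1) by (simp add: eigenval_def algebra_simps)
  ultimately show False using \<open>n \<noteq> m\<close> by simp
qed

text \<open>The two parities have disjoint spectra: by induction \<open>f\<close> is annihilated by
  \<open>C - \<lambda>\<^sub>n\<close>, while \<open>\<lambda>\<^sub>n\<close> is no eigenvalue on
  the filtration of \<open>m\<close>.\<close>

lemma hom_image_parity_disjoint:
  fixes f :: "('n::finite, 'k::field_char_0) sphere_alg"
  assumes "CARD('n) \<ge> 2" "hom_image m f" "hom_image n f" "even n \<noteq> even m"
  shows "f = 0"
  using assms(2-)
proof (induction n arbitrary: f rule: less_induct)
  case (less n)
  define h where "h = sphere_laplacian f - of_int (eigenval CARD('n) n) * f"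
  have "h = 0"
  proof (cases "n < 2")
    case True
    then show ?thesis using hom_image_laplacian_diff[OF less.prems(2)] by (simp add: h_def)
  next
    case False
    then have "hom_image (n - 2) h"
      using hom_image_laplacian_diff[OF less.prems(2)] by (simp add: h_def)
    moreover have "hom_image m h"
      unfolding h_def by (intro hom_image_diff hom_image_laplacian hom_image_of_int less.prems)
    ultimately show ?thesis
      using False less.prems(3) by (intro less.IH[of "n - 2"]) auto
  qed
  then have "f \<in> {0}"
    using less.prems eigenval_inj[OF _ assms(1), of n]
    by (intro mem_of_laplacian_diff_mem[of "{0}" m f "eigenval CARD('n) n"])
       (auto simp: h_def sphere_laplacian_def)
  then show ?case by simp
qed

text \<open>Splits off the constant component with the remainder in \<open>C U\<close>: for
  \<open>n > 0\<close> the eigenvalue \<open>\<lambda>\<^sub>n\<close> is nonzero, so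
  \<open>C\<close> can be inverted degree by degree. Odd degrees never descend to 0.\<close>

lemma const_plus_laplacian:
  fixes f :: "('n::finite, 'k::field_char_0) sphere_alg"
  assumes N: "CARD('n) \<ge> 2" and U: "gl_stable U" and f: "hom_image n f" "f \<in> U"
  shows "\<exists>c. \<exists>g\<in>U. f = K c + sphere_laplacian g \<and> (odd n \<longrightarrow> c = 0)"
  using f
proof (induction n arbitrary: f rule: less_induct)
  case (less n)
  note sub = gl_stable_subspace[OF U]
  define l where "l = eigenval CARD('n) n"
  show ?case
  proof (cases n)
    case 0
    then obtain c where "f = K c"
      using less.prems by (auto simp: hom_image_0_iff sphere_constants_def)
    then show ?thesis
      using 0 sphere_vs.subspace_0[OF sub]
      by (intro exI[of _ c] bexI[of _ 0]) (simp_all add: sphere_laplacian_def)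
  next
    case (Suc k)
    then have l: "l \<noteq> 0"
      using N by (simp add: l_def eigenval_def)
    define f' where "f' = sphere_laplacian f - of_int l * f"
    have f'U: "f' \<in> U"
      unfolding f'_def by (intro sphere_vs.subspace_diff subspace_of_int_mult sub
          gl_stable_laplacian[OF U] less.prems(2))
    have "\<exists>c. \<exists>g\<in>U. f' = K c + sphere_laplacian g \<and> (odd n \<longrightarrow> c = 0)"
    proof (cases "n < 2")
      case True
      then have "f' = 0"
        using hom_image_laplacian_diff[OF less.prems(1)] by (simp add: f'_def l_def)
      then show ?thesis
        using sphere_vs.subspace_0[OF sub]
        by (intro exI[of _ 0] bexI[of _ 0]) (simp_all add: sphere_laplacian_def)
    next
      case False
      then have "hom_image (n - 2) f'"
        using hom_image_laplacian_diff[OF less.prems(1)] by (simp add: f'_def l_def)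
      then obtain c g where "g \<in> U" "f' = K c + sphere_laplacian g"
        "odd (n - 2) \<longrightarrow> c = 0"
        using less.IH[of "n - 2" f'] f'U False by auto
      moreover have "odd (n - 2) = odd n" using False by auto
      ultimately show ?thesis by blast
    qed
    then obtain c g where g: "g \<in> U" "f' = K c + sphere_laplacian g"
      and c: "odd n \<longrightarrow> c = 0"
      by blast
    define r :: "('n, 'k) sphere_alg" where "r = sphere_of_poly (mconst (1 / of_int l))"
    have r: "r * (of_int l * f) = f" for f
      using l unfolding r_def sphere_scale_def[symmetric] sphere_scale_of_int[symmetric] by simp
    have "of_int l * f = sphere_laplacian (f - g) - K c"
      using g by (simp add: f'_def sphere_laplacian_diff algebra_simps)
    then have "f = r * (sphere_laplacian (f - g) - K c)"
      using r[of f] by simp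
    also have "\<dots> = sphere_of_poly (mconst (- c / of_int l)) + sphere_laplacian (r * (f - g))"
    proof -
      have "r * K c + sphere_of_poly (mconst (- c / of_int l)) = 0"
        unfolding r_def
        by (simp add: mconst_def mult_single single_add[symmetric] flip: sphere_of_poly_mult
            sphere_of_poly_add)
      then show ?thesis
        unfolding r_def sphere_laplacian_const_mult by (simp add: algebra_simps eq_neg_iff_add_eq_0)
    qed
    finally have "f = sphere_of_poly (mconst (- c / of_int l)) + sphere_laplacian (r * (f - g))" .
    moreover have "r * (f - g) \<in> U"
      unfolding r_def by (intro subspace_const_mult sphere_vs.subspace_diff sub g less.prems(2))
    ultimately show ?thesis using c by force
  qed
qed

section \<open>Quadratic stability and the odd part\<close>

text \<open>Euler's formula, when \<open>z\<close> is the degree of a homogeneous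
  representative.\<close>

lemma sum_sphere_var_partial:
  fixes f :: "('n::finite, 'k::comm_ring_1) sphere_alg"
  shows "(\<Sum>a\<in>UNIV. X a * (sphere_grad a f + of_int z * (X a * f))) = of_int z * f"
proof -
  have "(\<Sum>a\<in>UNIV. X a * (sphere_grad a f + of_int z * (X a * f)))
     = (\<Sum>a\<in>UNIV. X a * sphere_grad a f + (X a * X a) * (of_int z * f))"
    by (intro sum.cong) (simp_all add: algebra_simps)
  then show ?thesis
    unfolding sum.distrib sum_sphere_var_grad sum_distrib_right[symmetric] sphere_equation by simp
qed

text \<open>Second order partial derivatives of homogeneous representatives preserve \<open>J\<close> and lower the
  degree by two, so they lead down to degree \<open>0\<close> or \<open>1\<close>; by Euler's formula they cannot all
  vanish before.\<close>

lemma quad_gl_stable_generators: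
  fixes f :: "('n::finite, 'k::field_char_0) sphere_alg"
  assumes J: "gl_stable J" "quad_stable J" and f: "hom_image n f" "f \<in> J" "f \<noteq> 0"
  shows "if even n then 1 \<in> J else (\<forall>a. X a \<in> J)"
  using f
proof (induction n arbitrary: f rule: less_induct)
  case (less n)
  note sub = gl_stable_subspace[OF J(1)]
  define d :: "nat \<Rightarrow> 'n \<Rightarrow> ('n, 'k) sphere_alg \<Rightarrow> ('n, 'k) sphere_alg"
    where "d k a g = sphere_grad a g + of_int (int k) * (X a * g)" for k a g
  have hom_d: "hom_image k (d (Suc k) a g)" if "hom_image (Suc k) g" for k a g
    using hom_image_partial[OF that, of a] by (simp add: d_def)
  have euler: "g = 0" if "\<And>a. d (Suc k) a g = 0" for k g
    using sum_sphere_var_partial[of g "int (Suc k)"] that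
    by (intro of_int_mult_eq_0[of "int (Suc k)" g]) (simp_all add: d_def)
  consider "n = 0" | "n = 1" | m where "n = Suc (Suc m)"
    by (metis One_nat_def nat.exhaust)
  then show ?case
  proof cases
    case 1
    then obtain c where "f = K c"
      using less.prems by (auto simp: hom_image_0_iff sphere_constants_def)
    then have "K c * 1 \<in> J" "c \<noteq> 0"
      using less.prems by auto
    then have "1 \<in> J" by (rule subspace_const_mult_cancel[OF sub])
    then show ?thesis using 1 by simp
  next
    case 2
    then obtain a where a: "d 1 a f \<noteq> 0"
      using euler[of 0 f] less.prems(3) by auto
    have "hom_image 0 (d 1 a f)" using hom_d[of 0 f a] less.prems(1) 2 by simp
    then obtain c where c: "d 1 a f = K c"
      by (auto simp: hom_image_0_iff sphere_constants_def)
    \<comment> \<open>A nonzero partial derivative in degree 1 is a constant; multiplied by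
      \<open>x\<^sub>b\<close>, it is a combination of the action and a quadratic product on
      \<open>f\<close>.\<close>
    have "X b \<in> J" for b
    proof -
      have "X b * d 1 a f = X b * sphere_grad a f + X b * (X a * f)"
        by (simp add: d_def algebra_simps)
      also have "\<dots> \<in> J"
        by (intro sphere_vs.subspace_add sub gl_stableD[OF J(1)]
            quad_stableD[OF J(2)] less.prems(2))
      finally have "K c * X b \<in> J"
        unfolding c by (simp only: mult.commute)
      moreover have "c \<noteq> 0" using a c by auto
      ultimately show ?thesis by (rule subspace_const_mult_cancel[OF sub])
    qed
    then show ?thesis using 2 by simp
  next
    case (3 m)
    have "\<exists>a b. d (Suc m) b (d (Suc (Suc m)) a f) \<noteq> 0"
      using euler less.prems(3) by metis
    then obtain a b where ab: "d (Suc m) b (d (Suc (Suc m)) a f) \<noteq> 0" by blast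
    \<comment> \<open>Expanded so that each summand is an operator known to preserve
      \<open>J\<close>.\<close>
    have "d (Suc m) b (d (Suc (Suc m)) a f)
      = sphere_grad b (sphere_grad a f) + of_int ((int m + 2) * (if a = b then 1 else 0)) * f
        - of_int (int m + 2) * (X b * (X a * f)) + of_int (int m + 2) * (X a * sphere_grad b f)
        + of_int (int m + 1) * (X b * sphere_grad a f)
        + of_int ((int m + 1) * (int m + 2)) * (X b * (X a * f))"
      by (auto simp: d_def sphere_grad_add sphere_grad_mult sphere_grad_var algebra_simps)
    also have "\<dots> \<in> J"
      by (intro sphere_vs.subspace_add sphere_vs.subspace_diff subspace_of_int_mult
          sub less.prems(2)
          gl_stable_grad_grad[OF J(1)] gl_stableD[OF J(1)] quad_stableD[OF J(2)])
    finally have "d (Suc m) b (d (Suc (Suc m)) a f) \<in> J" .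
    moreover have "hom_image m (d (Suc m) b (d (Suc (Suc m)) a f))"
      using less.prems(1) 3 by (intro hom_d) simp
    ultimately show ?thesis
      using less.IH[of m "d (Suc m) b (d (Suc (Suc m)) a f)"] 3 ab by simp
  qed
qed

lemma parity_part_subset_quad_stable:
  assumes J: "quad_stable J" and gen: "if e then 1 \<in> J else (\<forall>a. X a \<in> J)"
  shows "parity_part e \<subseteq> J"
proof
  \<comment> \<open>The induction alternates parities, so the opposite parity carries the claim
    about products with one more coordinate.\<close>
  have "if even n = e then f \<in> J else (\<forall>a. X a * f \<in> J)" if "hom_image n f" for n f
    using that
  proof (induction rule: hom_image.induct)
    case (add n f g)
    then show ?case using J by (auto simp: quad_stable_def algebra_simps sphere_vs.subspace_add)
  next
    case (scale n f c)
    then show ?case using J subspace_const_mult[of J]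
      by (auto simp: quad_stable_def sphere_scale_def
          mult.left_commute[of "X _" "sphere_of_poly _"])
  qed (use J gen in \<open>auto simp: quad_stable_def\<close>)
  then show "f \<in> J" if "f \<in> parity_part e" for f
    using that by (force simp: parity_part_iff)
qed

text \<open>Odd elements have no constant component, so each is some \<open>C g\<close> with
  \<open>g \<in> U\<close>, and \<open>U\<close> is stable under quadratic products.\<close>

lemma gl_stable_odd:
  fixes U :: "('n::finite, 'k::field_char_0) sphere_alg set"
  assumes "CARD('n) \<ge> 2" and U: "gl_stable U" "U \<subseteq> parity_part False" "U \<noteq> {0}"
  shows "U = parity_part False"
proof (rule antisym[OF U(2)])
  note sub = gl_stable_subspace[OF U(1)]
  have odd: "\<exists>n. odd n \<and> hom_image n f" if "f \<in> U" for f
    using U(2) that by (auto simp: parity_part_iff)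
  have quad: "quad_stable U"
    unfolding quad_stable_def
  proof (intro conjI allI ballI sub)
    fix a b f assume f: "f \<in> U"
    with odd obtain n where "odd n" "hom_image n f" by blast
    with const_plus_laplacian[OF assms(1) U(1) _ f, of n] obtain g
      where "g \<in> U" "f = sphere_laplacian g"
      by auto
    with odd quad_mult_laplacian_mem[OF U(1)] show "X a * (X b * f) \<in> U" by blast
  qed
  obtain f where f: "f \<in> U" "f \<noteq> 0"
    using U(3) sphere_vs.subspace_0[OF sub] by blast
  with odd obtain n where "odd n" "hom_image n f" by blast
  with quad_gl_stable_generators[OF U(1) quad _ f, of n] have "\<forall>a. X a \<in> U" by simp
  then show "parity_part False \<subseteq> U" by (intro parity_part_subset_quad_stable quad) simp
qed

lemma const_mult_const: "K c * K d = K (c * d)"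
  by (simp add: mconst_def mult_single flip: sphere_of_poly_mult)

subsection \<open>The even part\<close>

lemma quad_mem_of_codim_le_1:
  fixes U :: "('n::finite, 'k::field_char_0) sphere_alg set"
  assumes N: "CARD('n) \<ge> 3" and U: "gl_stable U"
    and Q: "\<And>a b. \<exists>c. X a * X b - K c * Q \<in> U" and "a \<noteq> b"
  shows "X a * X b \<in> U"
proof (rule ccontr)
  note sub = gl_stable_subspace[OF U]
  define q :: "('n, 'k) sphere_alg" where "q = X a * X b"
  assume "X a * X b \<notin> U"
  then have q: "q \<notin> U" by (simp add: q_def)
  obtain d where d: "q - K d * Q \<in> U" using Q[of a b] by (auto simp: q_def)
  with q have "d \<noteq> 0" by auto
  have "\<exists>c. X i * X j - K c * q \<in> U" for i j
  proof -
    obtain c where c: "X i * X j - K c * Q \<in> U" using Q by blast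
    have "K (c / d) * (K d * Q) = K c * Q"
      using \<open>d \<noteq> 0\<close> by (simp add: const_mult_const flip: mult.assoc)
    then have "X i * X j - K (c / d) * q = (X i * X j - K c * Q) - K (c / d) * (q - K d * Q)"
      by (simp add: algebra_simps)
    also have "\<dots> \<in> U"
      by (intro sphere_vs.subspace_diff subspace_const_mult sub c d)
    finally show ?thesis by blast
  qed
  then have "\<forall>i j. \<exists>c. X i * X j - K c * q \<in> U" by blast
  then obtain \<gamma> where \<gamma>: "\<And>i j. X i * X j - K (\<gamma> i j) * q \<in> U"
    unfolding choice_iff by blast
  \<comment> \<open>The third index, needed for two rotations that do not commute, comes from
    \<open>N \<ge> 3\<close>.\<close>
  have "card {a, b} \<noteq> CARD('n)" using N by (simp add: \<open>a \<noteq> b\<close>)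
  then have "{a, b} \<noteq> UNIV" by force
  then obtain c where c: "c \<noteq> a" "c \<noteq> b" by blast
  \<comment> \<open>The scalars of \<open>\<Delta>\<^sub>a\<^sub>c\<close> and
    \<open>\<Delta>\<^sub>a\<^sub>b\<close> on \<open>q\<close> modulo \<open>U\<close>, as these
    send \<open>q\<close> to \<open>x\<^sub>b x\<^sub>c\<close> and
    \<open>x\<^sub>b\<^sup>2 - x\<^sub>a\<^sup>2\<close>.\<close>
  define s t :: "('n, 'k) sphere_alg" where "s = K (\<gamma> b c)" and "t = K (\<gamma> b b) - K (\<gamma> a a)"
  have s: "X b * X c - s * q \<in> U" using \<gamma> by (simp add: s_def)
  have "(X b * X b - K (\<gamma> b b) * q) - (X a * X a - K (\<gamma> a a) * q) \<in> U"
    by (intro sphere_vs.subspace_diff sub \<gamma>)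
  then have t: "X b * X b - X a * X a - t * q \<in> U" by (simp add: t_def algebra_simps)
  have s': "s * f \<in> U" and t': "t * f \<in> U" if "f \<in> U" for f
    using subspace_const_mult[OF sub that] sphere_vs.subspace_diff[OF sub]
    by (simp_all add: s_def t_def left_diff_distrib)
  have ds: "sphere_Delta i j s = 0" and dt: "sphere_Delta i j t = 0" for i j
    by (simp_all add: s_def t_def sphere_Delta_diff)
  \<comment> \<open>\<open>\<Delta>\<^sub>a\<^sub>b\<close> and \<open>\<Delta>\<^sub>a\<^sub>c\<close> act on the line spanned by \<open>q\<close> modulo \<open>U\<close> by scalars, which commute,
    while their commutator is \<open>\<plusminus>\<Delta>\<^sub>b\<^sub>c\<close>.\<close>
  have 1: "sphere_Delta a b (X b * X c - s * q) + s * (X b * X b - X a * X a - t * q) \<in> U"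
    by (intro sphere_vs.subspace_add sub gl_stable_Delta[OF U] s t s')
  have 2: "sphere_Delta a b (X b * X c - s * q) + s * (X b * X b - X a * X a - t * q)
      = - (X a * X c) - s * t * q"
    using c \<open>a \<noteq> b\<close> by (simp add: q_def sphere_Delta_diff sphere_Delta_mult sphere_Delta_var ds
        algebra_simps)
  have 3: "sphere_Delta a c (X b * X b - X a * X a - t * q) + t * (X b * X c - s * q) \<in> U"
    by (intro sphere_vs.subspace_add sub gl_stable_Delta[OF U] s t t')
  have 4: "sphere_Delta a c (X b * X b - X a * X a - t * q) + t * (X b * X c - s * q)
      = - 2 * (X a * X c) - s * t * q"
    using c \<open>a \<noteq> b\<close> by (simp add: q_def sphere_Delta_diff sphere_Delta_add sphere_Delta_mult
        sphere_Delta_var dt algebra_simps)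
  have "(- (X a * X c) - s * t * q) - (- 2 * (X a * X c) - s * t * q) \<in> U"
    by (rule sphere_vs.subspace_diff[OF sub 1[unfolded 2] 3[unfolded 4]])
  then have "X a * X c \<in> U" by (simp add: algebra_simps)
  from gl_stable_Delta[OF U this, of c b] have "q \<in> U"
    using c \<open>a \<noteq> b\<close> by (simp add: q_def sphere_Delta_mult sphere_Delta_var)
  with q show False by contradiction
qed

text \<open>Rotating \<open>x\<^sub>c x\<^sub>a\<close> gives
  \<open>x\<^sub>a\<^sup>2 - x\<^sub>c\<^sup>2\<close>; summing over \<open>c\<close> and adding 1
  yields \<open>N x\<^sub>a\<^sup>2\<close>.\<close>

lemma quad_mem_all:
  fixes U :: "('n::finite, 'k::field_char_0) sphere_alg set"
  assumes U: "gl_stable U" "1 \<in> U" and off: "\<And>a b. a \<noteq> b \<Longrightarrow> X a * X b \<in> U"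
  shows "X a * X b \<in> U"
proof (cases "a = b")
  case True
  note sub = gl_stable_subspace[OF U(1)]
  have "X a * X a - X c * X c \<in> U" for c
  proof (cases "a = c")
    case False
    then have "sphere_Delta c a (X c * X a) \<in> U"
      by (intro gl_stable_Delta[OF U(1)] off) simp
    then show ?thesis using False by (simp add: sphere_Delta_mult sphere_Delta_var)
  qed (simp add: sphere_vs.subspace_0[OF sub])
  then have "(\<Sum>c\<in>UNIV. X a * X a - X c * X c) + 1 \<in> U"
    by (intro sphere_vs.subspace_add sphere_vs.subspace_sum sub U)
  then have "of_int (int CARD('n)) * (X a * X a) \<in> U"
    by (simp add: sum_subtractf sphere_equation)
  from subspace_of_int_mult_cancel[OF sub this] True show ?thesis by simp
qed (rule off)

lemma gl_stable_even:
  fixes U :: "('n::finite, 'k::field_char_0) sphere_alg set"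
  assumes N: "CARD('n) \<ge> 3" and U: "gl_stable U" "U \<subseteq> parity_part True" "\<not> U \<subseteq> sphere_constants"
  shows "U = parity_part True"
proof (rule antisym[OF U(2)])
  note sub = gl_stable_subspace[OF U(1)]
  \<comment> \<open>The elements of \<open>U\<close> freed of constant components.\<close>
  define L where "L = sphere_laplacian ` U"
  have even: "\<exists>n. even n \<and> hom_image n f" if "f \<in> U" for f
    using U(2) that by (auto simp: parity_part_iff)
  have decomp: "\<exists>c. \<exists>g\<in>U. f = K c + sphere_laplacian g" if "f \<in> U" for f
    using even[OF that] const_plus_laplacian[OF _ U(1) _ that] N by fastforce
  have quad: "X a * (X b * sphere_laplacian f) \<in> U" if "f \<in> U" for a b f
    using even[OF that] quad_mult_laplacian_mem[OF U(1) _ that] by blast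
  have LU: "L \<subseteq> U"
    using gl_stable_laplacian[OF U(1)] by (auto simp: L_def)
  have subL: "sphere_vs.subspace L"
  proof (rule sphere_vs.subspaceI)
    show "0 \<in> L"
      unfolding L_def using sphere_vs.subspace_0[OF sub]
          by (intro image_eqI[of _ _ 0]) (simp_all add: sphere_laplacian_def)
    show "f + g \<in> L" if "f \<in> L" "g \<in> L" for f g
      using that sphere_vs.subspace_add[OF sub]
          by (auto simp: L_def simp flip: sphere_laplacian_add)
    show "sphere_scale c f \<in> L" if "f \<in> L" for c f
      using that subspace_const_mult[OF sub]
      by (auto simp: L_def sphere_scale_def simp flip: sphere_laplacian_const_mult)
  qed
  have "1 \<in> U \<and> (\<forall>a b. X a * X b \<in> U)"
  proof (cases "quad_stable L")
    case True
    have "gl_stable L"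
      unfolding gl_stable_def
    proof (intro conjI allI ballI subL)
      fix a b f assume "f \<in> L"
      \<comment> \<open>Rotations commute with \<open>C\<close>; quadratic stability then supplies
        the factors \<open>x\<^sub>b x\<^sub>p\<close>.\<close>
      then have "sphere_Delta a p f \<in> L" for p
        using gl_stable_Delta[OF U(1)] by (auto simp: L_def sphere_Delta_laplacian)
      then have "(\<Sum>p\<in>UNIV. X b * (X p * sphere_Delta a p f)) \<in> L"
        by (intro sphere_vs.subspace_sum subL quad_stableD[OF True])
      then show "X b * sphere_grad a f \<in> L"
        by (simp add: sphere_grad_def sum_distrib_left)
    qed
    moreover obtain f where f: "f \<in> L" "f \<noteq> 0"
    proof -
      obtain f where "f \<in> U" "f \<notin> sphere_constants" using U(3) by blast
      moreover from decomp[OF this(1)] obtain c g where "g \<in> U" "f = K c + sphere_laplacian g"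
          by blast
      ultimately have "sphere_laplacian g \<in> L" "sphere_laplacian g \<noteq> 0"
        by (auto simp: L_def sphere_constants_def)
      then show thesis by (rule that)
    qed
    moreover obtain n where "even n" "hom_image n f" using even f LU by blast
    ultimately have "1 \<in> L" using quad_gl_stable_generators[OF _ True, of n f] by simp
    then obtain g where "g \<in> U" "1 = sphere_laplacian g" by (auto simp: L_def)
    with quad[of g] have "X a * X b \<in> U" for a b by (metis mult.right_neutral)
    with \<open>1 \<in> L\<close> LU show ?thesis by blast
  next
    case False
    then obtain a0 b0 f0 where f0: "f0 \<in> U" and not: "X a0 * (X b0 * sphere_laplacian f0) \<notin> L"
      using subL by (auto simp: quad_stable_def L_def)
    obtain c g where g: "g \<in> U"
      and eq: "X a0 * (X b0 * sphere_laplacian f0) = K c + sphere_laplacian g"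
      using decomp[OF quad[OF f0]] by blast
    \<comment> \<open>With \<open>c = 0\<close> the product would be \<open>C g\<close>, an element
      of \<open>L\<close>.\<close>
    have "c \<noteq> 0" using not g eq by (auto simp: L_def)
    have "(K c + sphere_laplacian g) - sphere_laplacian g \<in> U"
      unfolding eq[symmetric] by (intro sphere_vs.subspace_diff sub quad f0
          gl_stable_laplacian[OF U(1)] g)
    then have 1: "1 \<in> U"
      using subspace_const_mult_cancel[OF sub _ \<open>c \<noteq> 0\<close>, of 1] by simp
    have "\<exists>d. X a * X b - K d * (X a0 * X b0) \<in> U" for a b
    proof -
      obtain d h where h: "h \<in> U"
        and eq': "X a * (X b * sphere_laplacian f0) = K d + sphere_laplacian h"
        using decomp[OF quad[OF f0]] by blast
      \<comment> \<open>Both sides are the product of \<open>C f0\<close> with all four coordinates.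
        Modulo \<open>U\<close> only the constants \<open>c\<close> and \<open>d\<close>
        contribute.\<close>
      have "X a * (X b * (K c + sphere_laplacian g)) = X a0 * (X b0 * (K d + sphere_laplacian h))"
        unfolding eq[symmetric] eq'[symmetric] by (simp only: mult_ac)
      then have "K c * (X a * X b) - K d * (X a0 * X b0)
         = X a0 * (X b0 * sphere_laplacian h) - X a * (X b * sphere_laplacian g)"
        by (simp add: algebra_simps)
      also have "\<dots> \<in> U"
        by (intro sphere_vs.subspace_diff sub quad g h)
      also have "K d * (X a0 * X b0) = K c * (K (d / c) * (X a0 * X b0))"
        using \<open>c \<noteq> 0\<close> by (simp add: const_mult_const flip: mult.assoc)
      finally have "K c * (X a * X b - K (d / c) * (X a0 * X b0)) \<in> U"
        by (simp add: right_diff_distrib)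
      from subspace_const_mult_cancel[OF sub this \<open>c \<noteq> 0\<close>] show ?thesis by blast
    qed
    from quad_mem_of_codim_le_1[OF N U(1) this] quad_mem_all[OF U(1) 1] 1 show ?thesis by blast
  qed
  then have 1: "1 \<in> U" and Q: "X a * X b \<in> U" for a b by blast+
  have "quad_stable U"
    unfolding quad_stable_def
  proof (intro conjI allI ballI sub)
    fix a b f assume "f \<in> U"
    then obtain c g where g: "g \<in> U" "f = K c + sphere_laplacian g" using decomp by blast
    then have "X a * (X b * f) = K c * (X a * X b) + X a * (X b * sphere_laplacian g)"
      by (simp add: algebra_simps)
    also have "\<dots> \<in> U"
      by (intro sphere_vs.subspace_add subspace_const_mult sub Q quad g)
    finally show "X a * (X b * f) \<in> U" .
  qed
  then show "parity_part True \<subseteq> U"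
    by (rule parity_part_subset_quad_stable) (simp add: 1)
qed

section \<open>Constants and conclusion\<close>

lemma sphere_constants_eq_span: "sphere_constants = sphere_vs.span {1}"
  by (auto simp: sphere_vs.span_singleton sphere_constants_def sphere_scale_def)

lemma dim_sphere_constants:
  "sphere_vs.dim (sphere_constants :: ('n::finite, 'k::field) sphere_alg set) = 1"
  unfolding sphere_constants_eq_span
  by (simp add: sphere_vs.dim_eq_card[of "{1}"] sphere_vs.dependent_single)

lemma gl_stable_constants: "gl_stable sphere_constants"
  unfolding gl_stable_def
proof (intro conjI allI ballI)
  show sub: "sphere_vs.subspace (sphere_constants :: ('a, 'b) sphere_alg set)"
    unfolding sphere_constants_eq_span by (rule sphere_vs.subspace_span)
  fix a b and f :: "('a, 'b) sphere_alg" assume "f \<in> sphere_constants"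
  then have "sphere_grad a f = 0" by (auto simp: sphere_constants_def)
  then show "X b * sphere_grad a f \<in> sphere_constants"
    using sphere_vs.subspace_0[OF sub] by simp
qed

lemma sphere_constants_subset_even: "sphere_constants \<subseteq> parity_part True"
  unfolding parity_part_iff subset_iff hom_image_0_iff[symmetric] by (metis even_zero)

text \<open>If all products of two coordinates were constant, rotations would kill them, forcing
  equal squares and vanishing mixed products.\<close>

lemma sphere_constants_neq_even:
  assumes "CARD('n::finite) \<ge> 2"
  shows "(sphere_constants :: ('n, 'k::field_char_0) sphere_alg set) \<noteq> parity_part True"
proof
  assume eq: "(sphere_constants :: ('n, 'k) sphere_alg set) = parity_part True"
  let ?X = "X :: 'n \<Rightarrow> ('n, 'k) sphere_alg"
  have sq: "?X b * ?X b = ?X a * ?X a" and 0: "a \<noteq> b \<Longrightarrow> ?X a * ?X b = 0" for a b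
  proof -
    have "hom_image 2 (?X a * (?X b * 1))"
      unfolding numeral_2_eq_2 by (intro hom_image.intros)
    then have "?X a * ?X b \<in> sphere_constants"
      unfolding eq parity_part_iff by (intro exI[of _ 2]) simp
    then have "sphere_Delta a b (?X a * ?X b) = 0"
      by (auto simp: sphere_constants_def)
    then show *: "?X b * ?X b = ?X a * ?X a"
      by (cases "a = b") (simp_all add: sphere_Delta_mult sphere_Delta_var)
    show "?X a * ?X b = 0" if "a \<noteq> b"
    proof (rule of_int_mult_eq_0[of 4])
      have "sphere_Delta a b (?X b * ?X b) = sphere_Delta a b (?X a * ?X a)"
        by (simp only: *)
      then show "of_int 4 * (?X a * ?X b) = 0"
        using that by (simp add: sphere_Delta_mult sphere_Delta_var algebra_simps)
    qed simp
  qed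
  obtain a b :: 'n where ab: "a \<noteq> b"
    using assms by (metis UNIV_I card_2_iff' card_le_Suc0_iff_eq finite
        not_less_eq_eq numeral_2_eq_2)
  have "1 = (\<Sum>c\<in>(UNIV :: 'n set). ?X a * ?X a)"
    unfolding sphere_equation[symmetric] by (intro sum.cong refl sq)
  \<comment> \<open>Each factor 1 is \<open>N\<close> times any square; different indices expose the
    vanishing mixed product.\<close>
  then have "(1 :: ('n, 'k) sphere_alg) * 1
      = of_nat CARD('n) * (?X a * ?X a) * (of_nat CARD('n) * (?X b * ?X b))"
    unfolding sq[of b a] by simp
  also have "\<dots> = of_nat CARD('n) * of_nat CARD('n) * ((?X a * ?X b) * (?X a * ?X b))"
    by (simp only: mult_ac)
  finally show False by (simp add: 0[OF ab])
qed

theorem proposition4p4: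
  assumes "CARD('n::finite) \<ge> 3"
  shows "sphere_mod.direct_sum_decomposition
           (sphere_odd :: ('n, 'k::{alg_closed_field, field_char_0}) sphere_alg set) sphere_even
    \<and> sphere_mod.irreducible (sphere_odd :: ('n, 'k) sphere_alg set)
    \<and> (\<forall>U :: ('n, 'k) sphere_alg set.
          (sphere_mod.submodule U \<and> U \<subseteq> sphere_even \<and> U \<noteq> sphere_even \<and> U \<noteq> {0})
          \<longleftrightarrow> U = sphere_constants)
    \<and> sphere_vs.dim (sphere_constants :: ('n, 'k) sphere_alg set) = 1"
proof (intro conjI allI)
  have N: "CARD('n) \<ge> 2" using assms by simp
  note sub = gl_stable_imp_submodule[OF gl_stable_parity_part]
  show "sphere_mod.direct_sum_decomposition (sphere_odd :: ('n, 'k) sphere_alg set) sphere_even"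
    unfolding sphere_mod.direct_sum_decomposition_def sphere_odd_eq sphere_even_eq
  proof (intro conjI sub)
    have "0 \<in> (parity_part e :: ('n, 'k) sphere_alg set)" for e
      by (simp add: parity_part_def sphere_vs.span_zero)
    moreover have "f = 0" if "f \<in> parity_part False" "f \<in> parity_part True"
        for f :: "('n, 'k) sphere_alg"
      using that hom_image_parity_disjoint[OF N, of _ f] by (auto simp: parity_part_iff)
    ultimately show "parity_part False \<inter> parity_part True = {0 :: ('n, 'k) sphere_alg}" by blast
    show "{u + w | u w. u \<in> parity_part False \<and> w \<in> parity_part True}
        = (UNIV :: ('n, 'k) sphere_alg set)"
      using parity_part_sum by blast
  qed
  show "sphere_mod.irreducible (sphere_odd :: ('n, 'k) sphere_alg set)"
    unfolding sphere_mod.irreducible_def sphere_odd_eq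
  proof (intro conjI sub allI impI)
    show "parity_part False \<noteq> {0 :: ('n, 'k) sphere_alg}"
    proof
      assume "parity_part False = {0 :: ('n, 'k) sphere_alg}"
      moreover have "X a * 1 \<in> (parity_part False :: ('n, 'k) sphere_alg set)" for a
        using hom_image_imp_parity_part[OF hom_image.var[OF hom_image.one, of a]] by simp
      ultimately have "X a = (0 :: ('n, 'k) sphere_alg)" for a by auto
      then have "(\<Sum>a\<in>UNIV. X a * X a) = (0 :: ('n, 'k) sphere_alg)" by simp
      then show False by (simp add: sphere_equation)
    qed
    show "W = {0} \<or> W = parity_part False"
      if "sphere_mod.submodule W \<and> W \<subseteq> parity_part False" for W :: "('n, 'k) sphere_alg set"
      using that gl_stable_odd[OF N submodule_imp_gl_stable] by blast
  qed
  show "(sphere_mod.submodule U \<and> U \<subseteq> sphere_even \<and> U \<noteq> sphere_even \<and> U \<noteq> {0})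
          \<longleftrightarrow> U = sphere_constants" for U :: "('n, 'k) sphere_alg set"
    unfolding sphere_even_eq
  proof
    assume U: "sphere_mod.submodule U \<and> U \<subseteq> parity_part True \<and> U \<noteq> parity_part True \<and> U \<noteq> {0}"
    then have "gl_stable U" by (blast intro: submodule_imp_gl_stable)
    note sub = gl_stable_subspace[OF this]
    from gl_stable_even[OF assms \<open>gl_stable U\<close>] U have const: "U \<subseteq> sphere_constants" by blast
    obtain f where f: "f \<in> U" "f \<noteq> 0"
      using U sphere_vs.subspace_0[OF sub] by blast
    with const obtain c where "f = K c"
      unfolding sphere_constants_def by blast
    with f have "K c * 1 \<in> U" "c \<noteq> 0" by auto
    then have "1 \<in> U" by (rule subspace_const_mult_cancel[OF sub])
    then show "U = sphere_constants"
      using const sphere_vs.span_minimal[of "{1}" U] sub unfolding sphere_constants_eq_span by blast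
  next
    assume "U = sphere_constants"
    moreover have K1: "K 1 \<in> (sphere_constants :: ('n, 'k) sphere_alg set)"
      unfolding sphere_constants_def by blast
    moreover have "(sphere_constants :: ('n, 'k) sphere_alg set) \<noteq> {0}"
    proof
      assume "(sphere_constants :: ('n, 'k) sphere_alg set) = {0}"
      with K1 have "K 1 \<in> {0 :: ('n, 'k) sphere_alg}" by (simp only:)
      then show False by simp
    qed
    ultimately show "sphere_mod.submodule U \<and> U \<subseteq> parity_part True \<and> U \<noteq> parity_part True \<and> U \<noteq> {0}"
      using gl_stable_imp_submodule[OF gl_stable_constants] sphere_constants_subset_even
        sphere_constants_neq_even[OF N] by blast
  qed
  show "sphere_vs.dim (sphere_constants :: ('n, 'k) sphere_alg set) = 1"
    by (rule dim_sphere_constants)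
qed

end
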